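(* Let $X$ be a real Banach space which does not contain an isomorphic copy of $\ell_1$, and let $\tau=\tau(X^*,X)$ be the Mackey topology on $X^*$. Then $$\tau\preceq\tau^{+}=\tau^{p}=\tau^{b}=\|\cdot\|^{*},$$ where $\|\cdot\|^*$ denotes the dual norm topology on $X^*$. That is, $\tau^{p}$ is the bound extension of $\tau$; hence $\tau^{p}=\tau(X^{*},X^{**})=\|\cdot\|^{*}$, and consequently $(X^{*},\tau^{p})$ is a bornological space.
   Context: The Mackey topology $\tau(X^*,X)$ on $X^*$ is the topology of uniform convergence on all weakly compact absolutely convex subsets of $X$; $\tau(X^*,X^{**})$ is the finest locally convex topology on $X^*$ with topological dual $X^{**}$. For topologies, $\mathcal T_1\preceq\mathcal T_2$ means $\mathcal T_1$ is weaker (coarser) than or equal to $\mathcal T_2$. For a Hausdorff locally convex space $(E,\tau)$: $\tau^{+}$ is the finest locally convex topology on $E$ with the same convergent sequences as $\tau$; $\tau^{p}$ is the finest locally convex topology on $E$ with the same precompact (totally bounded) sets as $\tau$; $\tau^{b}$, the bound extension of $\tau$, is the locally convex topology whose local base at $0$ consists of all circled convex subsets of $E$ that absorb every $\tau$-bounded subset of $E$. The space $(E,\tau)$ is bornological if $\tau=\tau^b$. *)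

theory Defs
  imports "HOL-Analysis.Analysis"
begin

section \<open>Locally convex topologies on a real vector space\<close>

definition circled :: "'e::real_vector set \<Rightarrow> bool" where
  "circled V \<longleftrightarrow> (\<forall>c x. \<bar>c\<bar> \<le> 1 \<longrightarrow> x \<in> V \<longrightarrow> c *\<^sub>R x \<in> V)"

definition absorbs :: "'e::real_vector set \<Rightarrow> 'e set \<Rightarrow> bool" where
  "absorbs V B \<longleftrightarrow> (\<exists>r>0. \<forall>c. r \<le> \<bar>c\<bar> \<longrightarrow> B \<subseteq> (\<lambda>x. c *\<^sub>R x) ` V)"

definition linear_topology :: "'e::real_vector topology \<Rightarrow> bool" where
  "linear_topology T \<longleftrightarrow>
     topspace T = UNIV \<and>
     continuous_map (prod_topology T T) T (\<lambda>(x, y). x + y) \<and>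
     continuous_map (prod_topology euclideanreal T) T (\<lambda>(c, x). c *\<^sub>R x)"

definition locally_convex_topology :: "'e::real_vector topology \<Rightarrow> bool" where
  "locally_convex_topology T \<longleftrightarrow> linear_topology T \<and> neighbourhood_base_at 0 convex T"

definition coarser :: "'e topology \<Rightarrow> 'e topology \<Rightarrow> bool"  (infix \<open>\<preceq>\<close> 50) where
  "S \<preceq> T \<longleftrightarrow> (\<forall>U. openin S U \<longrightarrow> openin T U)"

definition is_finest_lc :: "('e::real_vector topology \<Rightarrow> bool) \<Rightarrow> 'e topology \<Rightarrow> bool" where
  "is_finest_lc P T \<longleftrightarrow>
     locally_convex_topology T \<and> P T \<and> (\<forall>S. locally_convex_topology S \<longrightarrow> P S \<longrightarrow> S \<preceq> T)"

definition finest_lc :: "('e::real_vector topology \<Rightarrow> bool) \<Rightarrow> 'e topology" where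
  "finest_lc P = (THE T. is_finest_lc P T)"

lemma coarser_antisym: "S \<preceq> T \<Longrightarrow> T \<preceq> S \<Longrightarrow> S = T"
  by (auto simp: coarser_def topology_eq)

lemma finest_lc_eq: "is_finest_lc P T \<Longrightarrow> finest_lc P = T"
  unfolding finest_lc_def
  by (rule the_equality) (auto simp: is_finest_lc_def intro: coarser_antisym)


text \<open>The translation-invariant topology with local base \<open>\<B>\<close> at 0. The members of \<open>\<B>\<close> need not be
  open.\<close>

definition topology_of_local_base :: "'e::real_vector set set \<Rightarrow> 'e topology" where
  "topology_of_local_base \<B> = topology (\<lambda>S. \<forall>x\<in>S. \<exists>V\<in>\<B>. (\<lambda>v. x + v) ` V \<subseteq> S)"

lemma openin_topology_of_local_base:
  assumes "\<B> \<noteq> {}" and inter: "\<And>V W. V \<in> \<B> \<Longrightarrow> W \<in> \<B> \<Longrightarrow> \<exists>Z\<in>\<B>. Z \<subseteq> V \<inter> W"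
  shows "openin (topology_of_local_base \<B>) S \<longleftrightarrow> (\<forall>x\<in>S. \<exists>V\<in>\<B>. (\<lambda>v. x + v) ` V \<subseteq> S)"
proof -
  have "istopology (\<lambda>S. \<forall>x\<in>S. \<exists>V\<in>\<B>. (\<lambda>v. x + v) ` V \<subseteq> S)"
    unfolding istopology_def
  proof (intro conjI allI impI ballI)
    fix S T x
    assume S: "\<forall>x\<in>S. \<exists>V\<in>\<B>. (\<lambda>v. x + v) ` V \<subseteq> S"
      and T: "\<forall>x\<in>T. \<exists>V\<in>\<B>. (\<lambda>v. x + v) ` V \<subseteq> T" and x: "x \<in> S \<inter> T"
    then obtain V W where VW: "V \<in> \<B>" "W \<in> \<B>"
      "(\<lambda>v. x + v) ` V \<subseteq> S" "(\<lambda>v. x + v) ` W \<subseteq> T"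
      by blast
    from inter[OF VW(1,2)] obtain Z where "Z \<in> \<B>" "Z \<subseteq> V \<inter> W"
      by blast
    with VW(3,4) show "\<exists>V\<in>\<B>. (\<lambda>v. x + v) ` V \<subseteq> S \<inter> T"
      by (intro bexI[of _ Z]) (blast, assumption)
  next
    fix \<K> x
    assume "\<forall>S\<in>\<K>. \<forall>x\<in>S. \<exists>V\<in>\<B>. (\<lambda>v. x + v) ` V \<subseteq> S" and "x \<in> \<Union>\<K>"
    then show "\<exists>V\<in>\<B>. (\<lambda>v. x + v) ` V \<subseteq> \<Union>\<K>"
      by (meson Union_iff Union_upper subset_trans)
  qed
  then show ?thesis
    unfolding topology_of_local_base_def by (simp add: topology_inverse')
qed


section \<open>The topologies associated with a locally convex topology\<close>

definition same_convergent_sequences :: "'e topology \<Rightarrow> 'e topology \<Rightarrow> bool" where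
  "same_convergent_sequences S T \<longleftrightarrow>
     (\<forall>x l. limitin S x l sequentially \<longleftrightarrow> limitin T x l sequentially)"

definition precompact_in :: "'e::real_vector topology \<Rightarrow> 'e set \<Rightarrow> bool" where
  "precompact_in T A \<longleftrightarrow>
     (\<forall>U. openin T U \<longrightarrow> 0 \<in> U \<longrightarrow> (\<exists>F. finite F \<and> A \<subseteq> (\<Union>a\<in>F. (\<lambda>u. a + u) ` U)))"

definition bounded_in :: "'e::real_vector topology \<Rightarrow> 'e set \<Rightarrow> bool" where
  "bounded_in T B \<longleftrightarrow> (\<forall>U. openin T U \<longrightarrow> 0 \<in> U \<longrightarrow> absorbs U B)"

definition same_precompact_sets :: "'e::real_vector topology \<Rightarrow> 'e topology \<Rightarrow> bool" where
  "same_precompact_sets S T \<longleftrightarrow> (\<forall>A. precompact_in S A \<longleftrightarrow> precompact_in T A)"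

definition tau_plus :: "'e::real_vector topology \<Rightarrow> 'e topology" where
  "tau_plus T = finest_lc (\<lambda>S. same_convergent_sequences S T)"

definition tau_p :: "'e::real_vector topology \<Rightarrow> 'e topology" where
  "tau_p T = finest_lc (\<lambda>S. same_precompact_sets S T)"

definition bornivorous_discs :: "'e::real_vector topology \<Rightarrow> 'e set set" where
  "bornivorous_discs T = {V. circled V \<and> convex V \<and> (\<forall>B. bounded_in T B \<longrightarrow> absorbs V B)}"

definition bound_extension :: "'e::real_vector topology \<Rightarrow> 'e topology" where
  "bound_extension T = topology_of_local_base (bornivorous_discs T)"

definition bornological :: "'e::real_vector topology \<Rightarrow> bool" where
  "bornological T \<longleftrightarrow>
     locally_convex_topology T \<and> Hausdorff_space T \<and> T = bound_extension T"

lemma absorbs_Int: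
  assumes "absorbs V B" "absorbs W B"
  shows "absorbs (V \<inter> W) B"
proof -
  obtain r s where r: "r > 0" "\<And>c. r \<le> \<bar>c\<bar> \<Longrightarrow> B \<subseteq> (\<lambda>x. c *\<^sub>R x) ` V"
    and s: "s > 0" "\<And>c. s \<le> \<bar>c\<bar> \<Longrightarrow> B \<subseteq> (\<lambda>x. c *\<^sub>R x) ` W"
    using assms unfolding absorbs_def by blast
  have "B \<subseteq> (\<lambda>x. c *\<^sub>R x) ` (V \<inter> W)" if c: "max r s \<le> \<bar>c\<bar>" for c
  proof -
    have "inj (\<lambda>x::'a. c *\<^sub>R x)"
      using c r(1) by (auto simp: inj_def)
    then show ?thesis
      using r(2)[of c] s(2)[of c] c by (simp add: image_Int)
  qed
  then show ?thesis
    unfolding absorbs_def using r(1) by (intro exI[of _ "max r s"]) auto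
qed

lemma openin_bound_extension:
  "openin (bound_extension T) S \<longleftrightarrow> (\<forall>x\<in>S. \<exists>V\<in>bornivorous_discs T. (\<lambda>v. x + v) ` V \<subseteq> S)"
  unfolding bound_extension_def
proof (rule openin_topology_of_local_base)
  have "absorbs UNIV B" for B :: "'a set"
  proof -
    have "x \<in> range (\<lambda>x. c *\<^sub>R x)" if "1 \<le> \<bar>c\<bar>" for c :: real and x :: 'a
      using that by (intro range_eqI[of _ _ "inverse c *\<^sub>R x"]) auto
    then show ?thesis
      unfolding absorbs_def by (intro exI[of _ 1]) auto
  qed
  then have "UNIV \<in> bornivorous_discs T"
    by (auto simp: bornivorous_discs_def circled_def)
  then show "bornivorous_discs T \<noteq> {}"
    by blast
next
  fix V W assume "V \<in> bornivorous_discs T" "W \<in> bornivorous_discs T"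
  then have "V \<inter> W \<in> bornivorous_discs T"
    by (auto simp: bornivorous_discs_def circled_def intro: convex_Int absorbs_Int)
  then show "\<exists>Z\<in>bornivorous_discs T. Z \<subseteq> V \<inter> W"
    by blast
qed


section \<open>Topologies on the dual of a normed space\<close>

definition weak_topology :: "'a::real_normed_vector topology" where
  "weak_topology =
     pullback_topology UNIV (\<lambda>x (f::'a \<Rightarrow>\<^sub>L real). blinfun_apply f x)
       (product_topology (\<lambda>_. euclideanreal) UNIV)"

definition uniform_nhds_0 :: "'a::real_normed_vector set set \<Rightarrow> ('a \<Rightarrow>\<^sub>L real) set set" where
  "uniform_nhds_0 \<K> =
     {{f. \<forall>K\<in>\<F>. \<forall>x\<in>K. \<bar>blinfun_apply f x\<bar> < e} | \<F> e. finite \<F> \<and> \<F> \<subseteq> \<K> \<and> 0 < e}"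

definition uniform_convergence_topology ::
    "'a::real_normed_vector set set \<Rightarrow> ('a \<Rightarrow>\<^sub>L real) topology" where
  "uniform_convergence_topology \<K> = topology_of_local_base (uniform_nhds_0 \<K>)"

lemma openin_uniform_convergence_topology:
  "openin (uniform_convergence_topology \<K>) S \<longleftrightarrow>
     (\<forall>f\<in>S. \<exists>V\<in>uniform_nhds_0 \<K>. (\<lambda>g. f + g) ` V \<subseteq> S)"
  unfolding uniform_convergence_topology_def
proof (rule openin_topology_of_local_base)
  have "{f. \<forall>K\<in>{}. \<forall>x\<in>K. \<bar>blinfun_apply f x\<bar> < 1} \<in> uniform_nhds_0 \<K>"
    unfolding uniform_nhds_0_def by (rule CollectI, rule exI[of _ "{}"], rule exI[of _ 1]) auto
  then show "uniform_nhds_0 \<K> \<noteq> {}"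
    by blast
next
  fix V W assume "V \<in> uniform_nhds_0 \<K>" "W \<in> uniform_nhds_0 \<K>"
  then obtain \<F> d \<G> e where
    V: "V = {f. \<forall>K\<in>\<F>. \<forall>x\<in>K. \<bar>blinfun_apply f x\<bar> < d}" "finite \<F>" "\<F> \<subseteq> \<K>" "0 < d" and
    W: "W = {f. \<forall>K\<in>\<G>. \<forall>x\<in>K. \<bar>blinfun_apply f x\<bar> < e}" "finite \<G>" "\<G> \<subseteq> \<K>" "0 < e"
    unfolding uniform_nhds_0_def by blast
  have "{f. \<forall>K\<in>\<F> \<union> \<G>. \<forall>x\<in>K. \<bar>blinfun_apply f x\<bar> < min d e} \<in> uniform_nhds_0 \<K>"
    unfolding uniform_nhds_0_def using V(2-) W(2-)
    by (intro CollectI exI[of _ "\<F> \<union> \<G>"] exI[of _ "min d e"]) auto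
  then show "\<exists>Z\<in>uniform_nhds_0 \<K>. Z \<subseteq> V \<inter> W"
    unfolding V(1) W(1) by (rule rev_bexI) auto
qed

definition mackey_topology :: "('a::real_normed_vector \<Rightarrow>\<^sub>L real) topology" where
  "mackey_topology =
     uniform_convergence_topology {K. compactin weak_topology K \<and> convex K \<and> circled K}"

definition topological_dual :: "'e::real_vector topology \<Rightarrow> ('e \<Rightarrow> real) set" where
  "topological_dual T = {\<phi>. linear \<phi> \<and> continuous_map T euclideanreal \<phi>}"

text \<open>\<open>\<tau>(X\<^sup>*, X\<^sup>*\<^sup>*)\<close>; the range below is \<open>X\<^sup>*\<^sup>*\<close>, viewed as a set of functions on \<open>X\<^sup>*\<close>.\<close>

definition has_dual_bidual :: "('a::real_normed_vector \<Rightarrow>\<^sub>L real) topology \<Rightarrow> bool" where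
  "has_dual_bidual T \<longleftrightarrow>
     topological_dual T = range (blinfun_apply :: (('a \<Rightarrow>\<^sub>L real) \<Rightarrow>\<^sub>L real) \<Rightarrow> _)"

definition mackey_topology_bidual :: "('a::real_normed_vector \<Rightarrow>\<^sub>L real) topology" where
  "mackey_topology_bidual = finest_lc has_dual_bidual"

text \<open>The instance topology of \<open>'a \<Rightarrow>\<^sub>L real\<close> is the one of the operator norm.\<close>

definition dual_norm_topology :: "('a::real_normed_vector \<Rightarrow>\<^sub>L real) topology" where
  "dual_norm_topology = euclidean"


section \<open>Isomorphic copies of \<open>\<ell>\<^sub>1\<close>\<close>

definition l1 :: "(nat \<Rightarrow> real) set" where
  "l1 = {a. summable (\<lambda>n. \<bar>a n\<bar>)}"

definition l1_norm :: "(nat \<Rightarrow> real) \<Rightarrow> real" where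
  "l1_norm a = (\<Sum>n. \<bar>a n\<bar>)"

text \<open>A linear embedding of \<open>\<ell>\<^sub>1\<close> that is bounded and bounded below, that is, a linear homeomorphism
  onto its range.\<close>

definition contains_l1 :: "'a::real_normed_vector itself \<Rightarrow> bool" where
  "contains_l1 _ \<longleftrightarrow>
     (\<exists>(J :: (nat \<Rightarrow> real) \<Rightarrow> 'a) c C. 0 < c \<and>
        (\<forall>a\<in>l1. \<forall>b\<in>l1. J (\<lambda>n. a n + b n) = J a + J b) \<and>
        (\<forall>a\<in>l1. \<forall>t. J (\<lambda>n. t * a n) = t *\<^sub>R J a) \<and>
        (\<forall>a\<in>l1. c * l1_norm a \<le> norm (J a) \<and> norm (J a) \<le> C * l1_norm a))"

end

theory Submission
  imports Defs
begin

text \<open>Everything reduces to two facts: Mackey convergent sequences are norm convergent, and Mackey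
  precompact sets are norm precompact. A weakly null sequence lies in the image of the \<open>\<ell>\<^sub>1\<close> ball, a
  weakly compact disc, so it converges to 0 uniformly on any Mackey precompact set and on the range
  of any Mackey null sequence. If \<open>X\<close> contains no copy of \<open>\<ell>\<^sub>1\<close>, Rosenthal's theorem extracts a weakly
  Cauchy subsequence from every bounded sequence; its differences are weakly null, so the unit ball
  of \<open>X\<close> is precompact for uniform convergence on such a set of functionals, and Grothendieck's
  duality transfers this to norm precompactness of the set itself.

  The norm topology is the finest in each of the three classes because a convex set that is not a
  norm neighbourhood of 0 misses a fast null sequence or, in the case of the prescribed dual, because
  of the Hahn--Banach theorem and uniform boundedness.\<close>


section \<open>Hahn--Banach and uniform boundedness\<close>

text \<open>\<open>finest_lc\<close> is a definite description, so its values mean nothing until a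
  finest topology is exhibited. All three classes get the same witness, the norm topology, and each
  needs a proof of membership and one of maximality; the two facts on sequences and precompact sets
  are membership proofs. They depend on the geometry of \<open>X\<close>: for
  \<open>X = \<ell>\<^sub>1\<close> weakly compact sets are norm compact, so the coordinate
  functionals form a Mackey null sequence of norm 1.

  The obstacle is that Mackey convergence controls functionals only on weakly compact discs, and the
  unit ball need not be one. A finite net of the ball, uniform over the functionals at hand, takes
  its place. Such a net can be tested on sequences, which is why weakly null sequences, rather than
  general weakly compact sets, carry the argument.\<close>

definition sublinear :: "('e::real_vector \<Rightarrow> real) \<Rightarrow> bool" where
  "sublinear q \<longleftrightarrow> (\<forall>x y. q (x + y) \<le> q x + q y) \<and> (\<forall>t x. 0 < t \<longrightarrow> q (t *\<^sub>R x) = t * q x)"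

lemma sublinear_add: "sublinear q \<Longrightarrow> q (x + y) \<le> q x + q y"
  and sublinear_scale: "sublinear q \<Longrightarrow> 0 < t \<Longrightarrow> q (t *\<^sub>R x) = t * q x"
  by (auto simp: sublinear_def)

lemma sublinear_zero: "sublinear q \<Longrightarrow> q 0 = 0"
  using sublinear_scale[of q 2 0] by simp

lemma sublinear_minus: "sublinear q \<Longrightarrow> - q (- x) \<le> q x"
  using sublinear_add[of q x "- x"] sublinear_zero[of q] by simp

lemma sublinear_scale_nonneg: "sublinear q \<Longrightarrow> 0 \<le> t \<Longrightarrow> q (t *\<^sub>R x) = t * q x"
  using sublinear_zero[of q] sublinear_scale[of q t x] by (cases "t = 0") auto

text \<open>The infimum over \<open>t\<close> makes the functional as small as possible in direction \<open>- y\<close>; a minimal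
  sublinear functional therefore equals all its reductions, which forces additivity.\<close>

definition reduce :: "'e::real_vector \<Rightarrow> ('e \<Rightarrow> real) \<Rightarrow> 'e \<Rightarrow> real" where
  "reduce y q x = (INF t\<in>{0..}. q (x + t *\<^sub>R y) - t * q y)"

lemma bdd_below_reduce:
  assumes "sublinear q"
  shows "bdd_below ((\<lambda>t. q (x + t *\<^sub>R y) - t * q y) ` {0..})"
proof (rule bdd_belowI2)
  fix t :: real assume "t \<in> {0..}"
  then show "- q (- x) \<le> q (x + t *\<^sub>R y) - t * q y"
    using sublinear_add[OF assms, of "- x" "x + t *\<^sub>R y"] sublinear_scale_nonneg[OF assms, of t y] by simp
qed

lemma reduce_le:
  assumes "sublinear q" "0 \<le> t"
  shows "reduce y q x \<le> q (x + t *\<^sub>R y) - t * q y"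
  unfolding reduce_def using assms by (intro cINF_lower bdd_below_reduce) auto

lemma reduce_le_self: "sublinear q \<Longrightarrow> reduce y q x \<le> q x"
  using reduce_le[of q 0 y x] by simp

lemma sublinear_reduce:
  assumes q: "sublinear q"
  shows "sublinear (reduce y q)"
  unfolding sublinear_def
proof (intro conjI allI impI)
  fix x z
  have "reduce y q (x + z) - (q (z + t *\<^sub>R y) - t * q y) \<le> reduce y q x" if t: "0 \<le> t" for t
    unfolding reduce_def[of y q x]
  proof (rule cINF_greatest)
    fix s :: real assume s: "s \<in> {0..}"
    have "reduce y q (x + z) \<le> q ((x + s *\<^sub>R y) + (z + t *\<^sub>R y)) - (s + t) * q y"
      using reduce_le[OF q, of "s + t" y "x + z"] s t by (simp add: algebra_simps)
    also have "\<dots> \<le> q (x + s *\<^sub>R y) + q (z + t *\<^sub>R y) - (s + t) * q y"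
      using sublinear_add[OF q] by simp
    finally show "reduce y q (x + z) - (q (z + t *\<^sub>R y) - t * q y) \<le> q (x + s *\<^sub>R y) - s * q y"
      by (simp add: algebra_simps)
  qed auto
  then have "reduce y q (x + z) - reduce y q x \<le> q (z + t *\<^sub>R y) - t * q y" if "0 \<le> t" for t
    using that by (simp add: algebra_simps)
  then have "reduce y q (x + z) - reduce y q x \<le> reduce y q z"
    unfolding reduce_def[of y q z] by (intro cINF_greatest) auto
  then show "reduce y q (x + z) \<le> reduce y q x + reduce y q z"
    by simp
next
  \<comment> \<open>One inequality suffices: used with \<open>inverse t\<close> at the point
    \<open>t *\<^sub>R x\<close> it gives the reverse one.\<close>
  have le: "reduce y q (t *\<^sub>R x) \<le> t * reduce y q x" if t: "0 < t" for t x
  proof -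
    have "reduce y q (t *\<^sub>R x) / t \<le> reduce y q x"
      unfolding reduce_def[of y q x]
    proof (rule cINF_greatest)
      fix s :: real assume s: "s \<in> {0..}"
      have "reduce y q (t *\<^sub>R x) \<le> q (t *\<^sub>R (x + s *\<^sub>R y)) - (t * s) * q y"
        using reduce_le[OF q, of "t * s" y "t *\<^sub>R x"] s t by (simp add: algebra_simps)
      also have "\<dots> = t * (q (x + s *\<^sub>R y) - s * q y)"
        unfolding sublinear_scale[OF q t] by (simp add: algebra_simps)
      finally show "reduce y q (t *\<^sub>R x) / t \<le> q (x + s *\<^sub>R y) - s * q y"
        using t by (simp add: field_simps)
    qed auto
    then show ?thesis
      using t by (simp add: field_simps)
  qed
  fix t :: real and x assume t: "0 < t"
  have "reduce y q (inverse t *\<^sub>R (t *\<^sub>R x)) \<le> inverse t * reduce y q (t *\<^sub>R x)"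
    using t by (intro le) auto
  then have "t * reduce y q x \<le> reduce y q (t *\<^sub>R x)"
    using t by (simp add: field_simps)
  with le[OF t] show "reduce y q (t *\<^sub>R x) = t * reduce y q x"
    by (simp add: antisym)
qed

text \<open>Zorn's lemma for the reversed pointwise order. The infimum of a chain is finite because
  each member satisfies \<open>q x \<ge> - q (- x) \<ge> - p (- x)\<close>. It is subadditive
  because of any two members of the chain one lies below the other.\<close>

lemma minimal_sublinear_exists:
  fixes p :: "'e::real_vector \<Rightarrow> real"
  assumes p: "sublinear p"
  obtains q where "sublinear q" "q \<le> p" "\<And>q'. sublinear q' \<Longrightarrow> q' \<le> q \<Longrightarrow> q' = q"
proof -
  define A where "A = {q. sublinear q \<and> q \<le> p}"
  have "\<exists>m\<in>A. \<forall>a\<in>A. m \<ge> a \<longrightarrow> a = m"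
  proof (rule predicate_Zorn)
    show "partial_order_on A (relation_of (\<ge>) A)"
      by (rule partial_order_on_relation_ofI) auto
    fix C assume C: "C \<in> Chains (relation_of (\<ge>) A)"
    then have CA: "C \<subseteq> A" and tot: "\<And>a b. a \<in> C \<Longrightarrow> b \<in> C \<Longrightarrow> a \<le> b \<or> b \<le> a"
      unfolding Chains_def relation_of_def by auto
    show "\<exists>u\<in>A. \<forall>a\<in>C. a \<ge> u"
    proof (cases "C = {}")
      case True
      then show ?thesis using p by (auto simp: A_def)
    next
      case False
      define u where "u x = (INF q\<in>C. q x)" for x
      have subl: "sublinear q" and le_p: "q x \<le> p x" if "q \<in> C" for q x
        using that CA by (auto simp: A_def le_fun_def)
      have bdd: "bdd_below ((\<lambda>q. q x) ` C)" for x
      proof (rule bdd_belowI2)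
        fix q assume "q \<in> C"
        then show "- p (- x) \<le> q x"
          using le_p[of q "- x"] sublinear_minus[OF subl, of q x] by linarith
      qed
      have u_le: "u x \<le> q x" if "q \<in> C" for q x
        unfolding u_def using that by (intro cINF_lower bdd)
      have u_ge: "c \<le> u x" if "\<And>q. q \<in> C \<Longrightarrow> c \<le> q x" for c x
        unfolding u_def using that False by (intro cINF_greatest)
      have add: "u (x + y) \<le> q x + r y" if "q \<in> C" "r \<in> C" for q r x y
      proof -
        obtain s where s: "s \<in> C" "s \<le> q" "s \<le> r"
          using tot \<open>q \<in> C\<close> \<open>r \<in> C\<close> by (meson order_refl)
        have "u (x + y) \<le> s x + s y"
          using u_le[OF s(1), of "x + y"] sublinear_add[OF subl[OF s(1)], of x y] by linarith
        with s(2,3) show ?thesis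
          unfolding le_fun_def by (meson add_mono order_trans)
      qed
      have "u (x + y) - u x \<le> u y" for x y
      proof (rule u_ge)
        fix r assume r: "r \<in> C"
        have "u (x + y) - r y \<le> u x"
          using add[OF _ r] by (intro u_ge) (simp add: algebra_simps)
        then show "u (x + y) - u x \<le> r y" by simp
      qed
      moreover have sc: "u (t *\<^sub>R x) \<ge> t * u x" if "0 < t" for t x
      proof (rule u_ge)
        fix q assume q: "q \<in> C"
        show "t * u x \<le> q (t *\<^sub>R x)"
          using u_le[OF q, of x] sublinear_scale[OF subl[OF q] that, of x] that by simp
      qed
      have "u (t *\<^sub>R x) = t * u x" if "0 < t" for t x
        using sc[OF that, of x] sc[of "inverse t" "t *\<^sub>R x"] that by (simp add: field_simps)
      ultimately have "sublinear u"
        unfolding sublinear_def by (simp add: algebra_simps)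
      moreover from False obtain q where "q \<in> C" by blast
      then have "u \<le> p"
        using u_le le_p by (meson le_funI order_trans)
      ultimately show ?thesis
        using u_le by (intro bexI[of _ u]) (auto simp: A_def le_fun_def)
    qed
  qed
  then obtain m where "m \<in> A" "\<forall>a\<in>A. a \<le> m \<longrightarrow> a = m" by blast
  then show thesis
    by (intro that[of m]) (auto simp: A_def)
qed

lemma minimal_sublinear_linear:
  assumes q: "sublinear q" and min: "\<And>q'. sublinear q' \<Longrightarrow> q' \<le> q \<Longrightarrow> q' = q"
  shows "linear q"
proof -
  have red: "reduce y q = q" for y
    using q by (intro min sublinear_reduce) (auto simp: le_fun_def intro: reduce_le_self)
  \<comment> \<open>The parameter 1 in the infimum gives \<open>q x \<le> q (x + y) - q y\<close>,
    the reverse of subadditivity.\<close>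
  have add: "q (x + y) = q x + q y" for x y
    using reduce_le[OF q, of 1 y x] sublinear_add[OF q, of x y] by (simp add: red)
  have neg: "q (- x) = - q x" for x
    using add[of x "- x"] sublinear_zero[OF q] by simp
  have "q (t *\<^sub>R x) = t * q x" for t x
  proof (cases "0 \<le> t")
    case False
    then have "q (t *\<^sub>R x) = - q ((- t) *\<^sub>R x)"
      using neg[of "t *\<^sub>R x"] by simp
    with False show ?thesis
      by (subst (asm) sublinear_scale[OF q]) auto
  qed (use q in \<open>simp add: sublinear_scale_nonneg\<close>)
  with add show ?thesis
    by (intro linearI) auto
qed

text \<open>Minimising below \<open>reduce z p\<close> instead of \<open>p\<close> fixes the value
  at \<open>z\<close>: the reduction is at most \<open>p 0 - p z = - p z\<close> at
  \<open>- z\<close>, so a linear minorant is at least \<open>p z\<close> at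
  \<open>z\<close>.\<close>

theorem Hahn_Banach_point:
  fixes p :: "'e::real_vector \<Rightarrow> real"
  assumes "sublinear p"
  obtains \<phi> where "linear \<phi>" "\<And>x. \<phi> x \<le> p x" "\<phi> z = p z"
proof -
  obtain q where q: "sublinear q" "q \<le> reduce z p"
    "\<And>q'. sublinear q' \<Longrightarrow> q' \<le> q \<Longrightarrow> q' = q"
    using minimal_sublinear_exists[OF sublinear_reduce[OF assms]] by metis
  then have "linear q" by (blast intro: minimal_sublinear_linear)
  moreover have le: "q x \<le> p x" for x
    using q(2) reduce_le_self[OF assms, of z x] by (meson le_fun_def order_trans)
  moreover have "q (- z) \<le> - p z"
    using q(2) reduce_le[OF assms, of 1 z "- z"] sublinear_zero[OF assms]
    by (auto simp: le_fun_def intro: order_trans)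
  then have "q z = p z"
    using le[of z] linear_neg[OF \<open>linear q\<close>, of z] by simp
  ultimately show thesis using that by blast
qed

section \<open>Norming functionals and the Baire argument for uniform boundedness\<close>

lemma norming_functional:
  fixes x :: "'a::real_normed_vector"
  obtains f :: "'a \<Rightarrow>\<^sub>L real" where "norm f \<le> 1" "f x = norm x"
proof -
  have "sublinear (norm :: 'a \<Rightarrow> real)"
    by (auto simp: sublinear_def norm_triangle_ineq)
  then obtain \<phi> :: "'a \<Rightarrow> real" where \<phi>: "linear \<phi>" "\<And>y. \<phi> y \<le> norm y" "\<phi> x = norm x"
    using Hahn_Banach_point by metis
  have le: "\<bar>\<phi> y\<bar> \<le> norm y" for y
    using \<phi>(2)[of y] \<phi>(2)[of "- y"] linear_neg[OF \<phi>(1), of y] by simp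
  then have "bounded_linear \<phi>"
    using \<phi>(1) by (auto simp: linear_conv_bounded_linear bounded_linear_def bounded_linear_axioms_def
        intro!: exI[of _ 1])
  then have *: "blinfun_apply (Blinfun \<phi>) = \<phi>"
    by (rule bounded_linear_Blinfun_apply)
  then have "norm (Blinfun \<phi>) \<le> 1"
    using le by (intro norm_blinfun_bound) auto
  with * \<phi>(3) show thesis
    by (intro that[of "Blinfun \<phi>"]) auto
qed

text \<open>The sets \<open>E n\<close> are closed and cover the space, so by Baire one of them
  contains a ball. A vector of length \<open>r\<close> is the difference of two points of that ball,
  which bounds every member of the family by \<open>2 * n\<close> there.\<close>

theorem uniform_boundedness:
  fixes F :: "('b::banach \<Rightarrow>\<^sub>L 'c::real_normed_vector) set"
  assumes pointwise: "\<And>x. \<exists>M. \<forall>f\<in>F. norm (f x) \<le> M"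
  obtains M where "0 < M" "\<And>f. f \<in> F \<Longrightarrow> norm f \<le> M"
proof -
  define E where "E n = {x. \<forall>f\<in>F. norm (blinfun_apply f x) \<le> real n}" for n
  have closed_E: "closed (E n)" for n
  proof -
    have "E n = (\<Inter>f\<in>F. {x. norm (blinfun_apply f x) \<le> real n})"
      by (auto simp: E_def)
    then show ?thesis
      by (auto intro!: closed_INT closed_Collect_le continuous_intros)
  qed
  have "\<exists>n. interior (E n) \<noteq> {}"
  proof (rule ccontr)
    assume "\<nexists>n. interior (E n) \<noteq> {}"
    then have "euclidean interior_of \<Union>(range E) = {}"
      using closed_E
      by (intro Baire_category_alt disjI1 completely_metrizable_space_euclidean) auto
    moreover have "x \<in> (\<Union>n. E n)" for x
    proof -
      obtain M where "\<forall>f\<in>F. norm (blinfun_apply f x) \<le> M" using pointwise by blast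
      moreover obtain n where "M \<le> real n" using real_arch_simple by blast
      ultimately have "x \<in> E n" unfolding E_def by force
      then show ?thesis by blast
    qed
    then have "\<Union>(range E) = UNIV" by blast
    ultimately show False by simp
  qed
  then obtain n z where "z \<in> interior (E n)" by blast
  then obtain r where r: "0 < r" "cball z r \<subseteq> E n"
    unfolding mem_interior_cball by blast
  show thesis
  proof (rule that)
    \<comment> \<open>The summand 1 keeps the bound positive when \<open>n = 0\<close>.\<close>
    show "0 < 2 * real n / r + 1" using r(1) by (simp add: add_nonneg_pos)
    fix f assume f: "f \<in> F"
    have "norm (blinfun_apply f x) \<le> 2 * real n / r * norm x" for x
    proof (cases "x = 0")
      case False
      define y where "y = (r / norm x) *\<^sub>R x"
      have "z \<in> E n" "z + y \<in> E n"
        using r False by (auto simp: y_def dist_norm intro!: subsetD[OF r(2)])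
      then have "norm (f z) \<le> n" "norm (f (z + y)) \<le> n"
        using f by (auto simp: E_def)
      moreover have "norm (f y) = norm (f (z + y) - f z)" by (simp add: blinfun.add_right)
      ultimately have "norm (f y) \<le> 2 * real n"
        using norm_triangle_ineq4[of "f (z + y)" "f z"] by linarith
      then show ?thesis
        using r(1) False by (simp add: y_def blinfun.scaleR_right field_simps)
    qed simp
    then have "norm f \<le> 2 * real n / r"
      using r(1) by (intro norm_blinfun_bound) auto
    then show "norm f \<le> 2 * real n / r + 1" by simp
  qed
qed

section \<open>A Ramsey theorem of Galvin and Rosenthal's theorem\<close>

definition beyond :: "nat set \<Rightarrow> nat set \<Rightarrow> nat set" where
  "beyond s M = {n \<in> M. \<forall>a\<in>s. a < n}"

lemma infinite_beyond:
  assumes "finite s" "infinite M"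
  shows "infinite (beyond s M)"
proof -
  obtain b where "s \<subseteq> {..b}"
    using assms(1) finite_nat_iff_bounded_le by blast
  then have "M \<subseteq> beyond s M \<union> {..b}"
    by (force simp: beyond_def)
  then show ?thesis
    using assms(2) finite_subset by auto
qed

text \<open>A diagonal argument: \<open>Q s\<close> is secured at the stage at which the maximum of \<open>s\<close> is chosen, and later
  choices only affect the part of \<open>N\<close> beyond \<open>s\<close>.\<close>

lemma fusion:
  fixes Q :: "nat set \<Rightarrow> nat set \<Rightarrow> bool"
  assumes mono: "\<And>s M N. Q s M \<Longrightarrow> N \<subseteq> M \<Longrightarrow> infinite N \<Longrightarrow> Q s N"
    and thin: "\<And>s M. finite s \<Longrightarrow> infinite M \<Longrightarrow> \<exists>N\<subseteq>M. infinite N \<and> Q s N"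
    and tail: "\<And>s M. finite s \<Longrightarrow> infinite M \<Longrightarrow> Q s (beyond s M) \<Longrightarrow> Q s M"
    and M: "infinite M"
  obtains N where "N \<subseteq> M" "infinite N" "\<And>s. finite s \<Longrightarrow> s \<subseteq> N \<Longrightarrow> Q s N"
proof -
  have all: "\<exists>N\<subseteq>M. infinite N \<and> (\<forall>s\<in>S. Q s N)"
    if "finite S" "\<And>s. s \<in> S \<Longrightarrow> finite s" "infinite M" for S M
    using that
  proof (induction S)
    case (insert s S)
    then obtain N where N: "N \<subseteq> M" "infinite N" "\<forall>s\<in>S. Q s N" by auto
    with insert.prems thin[of s N] obtain N' where "N' \<subseteq> N" "infinite N'" "Q s N'" by auto
    with N show ?case by (intro exI[of _ N']) (auto intro: mono)
  qed auto
  text \<open>A stage consists of the finite set chosen so far and the infinite reservoir.\<close>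
  define P where "P = (\<lambda>_::nat. \<lambda>(F, R). finite F \<and> F \<subseteq> M \<and> R \<subseteq> M \<and> infinite R \<and> beyond F R = R
      \<and> (\<forall>s\<subseteq>F. Q s R))"
  define next_stage where "next_stage = (\<lambda>_::nat. \<lambda>(F, R) (F', R' :: nat set).
      F' = insert (LEAST n. n \<in> R) F \<and> R' \<subseteq> R)"
  have "\<exists>x. P 0 x"
  proof -
    from thin[OF finite.emptyI M] obtain R where "R \<subseteq> M" "infinite R" "Q {} R" by blast
    then have "P 0 ({}, R)"
      by (auto simp: P_def beyond_def)
    then show ?thesis by blast
  qed
  moreover have "\<exists>y. P (Suc n) y \<and> next_stage n x y" if "P n x" for n x
  proof -
    obtain F R where x: "x = (F, R)" by fastforce
    define m where "m = (LEAST n. n \<in> R)"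
    have F: "finite F" "F \<subseteq> M" "R \<subseteq> M" "infinite R" "beyond F R = R"
      using that by (auto simp: P_def x)
    then have m: "m \<in> R"
      unfolding m_def by (metis LeastI_ex finite.emptyI ex_in_conv)
    \<comment> \<open>All subsets of \<open>insert m F\<close>, finitely many, are secured in one
      thinning; this restores the invariant \<open>P\<close> for the enlarged finite part.\<close>
    obtain R' where R': "R' \<subseteq> beyond (insert m F) R" "infinite R'" "\<forall>s\<in>Pow (insert m F). Q s R'"
      using all[of "Pow (insert m F)" "beyond (insert m F) R"] F infinite_beyond
      by (auto intro: finite_subset)
    have "P (Suc n) (insert m F, R')"
      using F m R' by (auto simp: P_def beyond_def)
    moreover have "next_stage n x (insert m F, R')"
      using R'(1) by (auto simp: x next_stage_def m_def beyond_def)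
    ultimately show ?thesis by blast
  qed
  ultimately obtain f where f: "\<And>n. P n (f n) \<and> next_stage n (f n) (f (Suc n))"
    using dependent_nat_choice[of P next_stage] by blast
  define F where "F n = fst (f n)" for n
  define R where "R n = snd (f n)" for n
  define m where "m n = (LEAST k. k \<in> R n)" for n
  have fin: "finite (F n)" and FM: "F n \<subseteq> M" and inf: "infinite (R n)" and RM: "R n \<subseteq> M"
    and bey: "beyond (F n) (R n) = R n" and Q: "s \<subseteq> F n \<Longrightarrow> Q s (R n)"
    and F_Suc: "F (Suc n) = insert (m n) (F n)" and R_Suc: "R (Suc n) \<subseteq> R n" for n s
    using f[of n] unfolding P_def next_stage_def F_def R_def m_def by (auto split: prod.splits)
  have m_R: "m n \<in> R n" for n
    unfolding m_def using inf[of n] by (metis LeastI_ex finite.emptyI ex_in_conv)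
  have F_mono: "F i \<subseteq> F j" and R_mono: "R j \<subseteq> R i" if "i \<le> j" for i j
    by (rule lift_Suc_mono_le[OF _ that], simp add: F_Suc subset_insertI)
      (rule lift_Suc_antimono_le[of R, OF R_Suc that])
  define N where "N = range m"
  have m_F: "m i \<in> F j" if "i < j" for i j
    using F_Suc[of i] F_mono[of "Suc i" j] that by auto
  have m_less: "m i < m j" if "i < j" for i j
    using m_F[OF that] m_R[of j] bey[of j] by (auto simp: beyond_def)
  then have sm: "strict_mono m" by (auto simp: strict_mono_def)
  show thesis
  proof (rule that)
    show "N \<subseteq> M" using m_R RM by (auto simp: N_def)
    show inf_N: "infinite N"
      using sm by (simp add: N_def finite_image_iff strict_mono_imp_inj_on)
    fix s assume s: "finite s" "s \<subseteq> N"
    have "\<exists>n. s \<subseteq> F n \<and> beyond s N \<subseteq> R n"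
    proof (cases "s = {}")
      case True
      then show ?thesis using m_R R_mono by (force simp: N_def beyond_def)
    next
      case False
      then have "Max s \<in> s" using s by simp
      with s obtain k where k: "Max s = m k" by (auto simp: N_def)
      have "s \<subseteq> F (Suc k)"
      proof
        fix a assume "a \<in> s"
        with s obtain i where "a = m i" by (auto simp: N_def)
        moreover have "a \<le> m k" using \<open>a \<in> s\<close> s k Max_ge by metis
        ultimately have "i \<le> k" using sm by (simp add: strict_mono_less_eq)
        then show "a \<in> F (Suc k)" using \<open>a = m i\<close> m_F by simp
      qed
      moreover have "beyond s N \<subseteq> R (Suc k)"
      proof
        fix a assume a: "a \<in> beyond s N"
        then obtain i where i: "a = m i" by (auto simp: N_def beyond_def)
        have "m k < m i" using a \<open>Max s \<in> s\<close> k i by (auto simp: beyond_def)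
        then have "Suc k \<le> i" using sm by (simp add: strict_mono_less)
        then show "a \<in> R (Suc k)" using i m_R R_mono by blast
      qed
      ultimately show ?thesis by blast
    qed
    then obtain n where "s \<subseteq> F n" "beyond s N \<subseteq> R n" by blast
    then have "Q s (beyond s N)"
      using mono[OF Q[of s n]] infinite_beyond[OF s(1) inf_N] by simp
    then show "Q s N"
      by (rule tail[OF s(1) inf_N])
  qed
qed

text \<open>Combinatorial forcing. A finite \<open>s\<close> accepts \<open>M\<close> if every
  infinite continuation of \<open>s\<close> inside \<open>M\<close> has an initial segment in
  \<open>\<F>\<close>, and rejects \<open>M\<close> if it accepts no infinite subset of
  \<open>M\<close>. A first fusion makes every finite subset of \<open>M'\<close> decided. If
  \<open>{}\<close> accepts, the second alternative holds; if it rejects, a second fusion makes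
  rejection pass to all finite subsets of some \<open>N\<close>, and a member of \<open>\<F>\<close>
  can never be rejected.\<close>

theorem Galvin:
  fixes \<F> :: "nat set set"
  assumes fin: "\<And>s. s \<in> \<F> \<Longrightarrow> finite s" and M: "infinite M"
  obtains N where "N \<subseteq> M" "infinite N"
    "(\<forall>s\<subseteq>N. s \<notin> \<F>) \<or> (\<forall>P\<subseteq>N. infinite P \<longrightarrow> (\<exists>k. P \<inter> {..<k} \<in> \<F>))"
proof -
  define W where "W A \<longleftrightarrow> (\<exists>k::nat. A \<inter> {..<k} \<in> \<F>)" for A
  define accepts where
    "accepts s M \<longleftrightarrow> (\<forall>P\<subseteq>beyond s M. infinite P \<longrightarrow> W (s \<union> P))" for s M
  define rejects where "rejects s M \<longleftrightarrow> (\<forall>N\<subseteq>M. infinite N \<longrightarrow> \<not> accepts s N)" for s M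
  have acc_mono: "accepts s N" if "accepts s M" "N \<subseteq> M" for s M N
    using that unfolding accepts_def beyond_def by blast
  have rej_mono: "rejects s N" if "rejects s M" "N \<subseteq> M" for s M N
    using that unfolding rejects_def by blast
  have acc_tail: "accepts s M" if "accepts s (beyond s M)" for s M
    using that unfolding accepts_def beyond_def by auto
  have rej_tail: "rejects s M" if "rejects s (beyond s M)" "finite s" for s M
    unfolding rejects_def
  proof (intro allI impI notI)
    fix N assume N: "N \<subseteq> M" "infinite N" "accepts s N"
    then have "accepts s (beyond s N)"
      by (auto simp: beyond_def intro: acc_mono)
    moreover have "beyond s N \<subseteq> beyond s M" "infinite (beyond s N)"
      using N infinite_beyond[OF that(2)] by (auto simp: beyond_def)
    ultimately show False using that(1) by (auto simp: rejects_def)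
  qed
  obtain M' where M': "M' \<subseteq> M" "infinite M'"
    and dec: "\<And>s. finite s \<Longrightarrow> s \<subseteq> M' \<Longrightarrow> accepts s M' \<or> rejects s M'"
  proof (rule fusion[where Q = "\<lambda>s M. accepts s M \<or> rejects s M" and M = M])
    show "infinite M" by (rule M)
    fix s and M N :: "nat set"
    show "accepts s M \<or> rejects s M \<Longrightarrow> N \<subseteq> M \<Longrightarrow> accepts s N \<or> rejects s N"
      using acc_mono rej_mono by metis
    show "finite s \<Longrightarrow> accepts s (beyond s M) \<or> rejects s (beyond s M) \<Longrightarrow> accepts s M \<or> rejects s M"
      using acc_tail rej_tail by metis
    show "infinite M \<Longrightarrow> \<exists>N\<subseteq>M. infinite N \<and> (accepts s N \<or> rejects s N)"
      unfolding rejects_def by (metis order_refl)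
  qed blast
  show thesis
  proof (cases "rejects {} M'")
    case False
    then have "accepts {} M'" using dec by blast
    then have "\<forall>P\<subseteq>M'. infinite P \<longrightarrow> W P"
      by (auto simp: accepts_def beyond_def)
    then show thesis using that[of M'] M' by (auto simp: W_def)
  next
    case True
    \<comment> \<open>Rejection is to pass from \<open>s\<close> to every one-point end extension
      inside \<open>N\<close>. The two guards make \<open>Q\<close> vacuous for the other sets,
      since \<open>fusion\<close> asks for thinning at every finite \<open>s\<close>.\<close>
    define Q where "Q s N \<longleftrightarrow> s \<subseteq> M' \<longrightarrow> rejects s M' \<longrightarrow>
        (\<forall>n\<in>beyond s N. n \<in> M' \<longrightarrow> rejects (insert n s) M')" for s N
    obtain N where N: "N \<subseteq> M'" "infinite N" and QN: "\<And>s. finite s \<Longrightarrow> s \<subseteq> N \<Longrightarrow> Q s N"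
    proof (rule fusion[where Q = Q and M = M'])
      show "infinite M'" by fact
      show "Q s N" if "Q s M" "N \<subseteq> M" for s and M N :: "nat set"
        using that by (auto simp: Q_def beyond_def)
      show "Q s M" if "Q s (beyond s M)" for s and M :: "nat set"
        using that by (auto simp: Q_def beyond_def)
      fix s M :: "nat set" assume s: "finite s" and M: "infinite M"
      show "\<exists>N\<subseteq>M. infinite N \<and> Q s N"
      proof (cases "s \<subseteq> M' \<and> rejects s M'")
        case True
        define B where "B = {n\<in>beyond s M'. accepts (insert n s) M'}"
        \<comment> \<open>If \<open>B\<close> were infinite, \<open>s\<close> would accept it: an
          infinite subset of \<open>B\<close> past \<open>s\<close> begins with some
          \<open>n\<close> in \<open>B\<close>, and its remaining points continue
          \<open>insert n s\<close>, which accepts \<open>M'\<close>. This contradicts the rejection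
          by \<open>s\<close>.\<close>
        have "finite B"
        proof (rule ccontr)
          assume B: "infinite B"
          have "accepts s B"
            unfolding accepts_def
          proof (intro allI impI)
            fix P assume P: "P \<subseteq> beyond s B" "infinite P"
            define n where "n = (LEAST n. n \<in> P)"
            have n: "n \<in> P" unfolding n_def using P(2) by (metis LeastI_ex finite.emptyI ex_in_conv)
            have least: "n \<le> a" if "a \<in> P" for a unfolding n_def using that by (rule Least_le)
            have "n \<in> B" using n P(1) by (auto simp: beyond_def)
            then have "accepts (insert n s) M'" by (simp add: B_def)
            moreover have "P - {n} \<subseteq> beyond (insert n s) M'"
              using P(1) least by (force simp: beyond_def B_def)
            moreover have "infinite (P - {n})" using P(2) by simp
            ultimately have "W (insert n s \<union> (P - {n}))"
              unfolding accepts_def by blast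
            moreover have "insert n s \<union> (P - {n}) = s \<union> P" using n by blast
            ultimately show "W (s \<union> P)" by simp
          qed
          moreover have "B \<subseteq> M'" by (auto simp: B_def beyond_def)
          ultimately show False using True B by (auto simp: rejects_def)
        qed
        then have "infinite (M - B)" using M by simp
        moreover have "Q s (M - B)"
          unfolding Q_def
        proof (intro impI ballI)
          fix n assume n: "n \<in> beyond s (M - B)" "n \<in> M'"
          then have "\<not> accepts (insert n s) M'" by (auto simp: B_def beyond_def)
          then show "rejects (insert n s) M'"
            using dec[of "insert n s"] n(2) s True by auto
        qed
        ultimately show ?thesis by blast
      next
        case False
        then show ?thesis using M by (auto simp: Q_def)
      qed
    qed blast
    have rej: "s \<subseteq> N \<longrightarrow> rejects s M'" if "finite s" for s
      using that
    proof (induction s rule: finite_linorder_max_induct)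
      case empty
      then show ?case using True by simp
    next
      case (insert b s)
      show ?case
      proof
        assume sub: "insert b s \<subseteq> N"
        then have "Q s N" using QN insert.hyps(1) by simp
        moreover have "b \<in> beyond s N" using sub insert.hyps(2) by (auto simp: beyond_def)
        moreover have "rejects s M'" using insert.IH sub by simp
        moreover have "s \<subseteq> M'" "b \<in> M'" using sub N(1) by auto
        ultimately show "rejects (insert b s) M'"
          unfolding Q_def by simp
      qed
    qed
    have "s \<notin> \<F>" if "s \<subseteq> N" for s
    proof
      assume s: "s \<in> \<F>"
      \<comment> \<open>Cutting \<open>s \<union> P\<close> at the least element of \<open>P\<close>
        gives back \<open>s\<close>, which is itself the required initial segment.\<close>
      have "accepts s N"
        unfolding accepts_def
      proof (intro allI impI)
        fix P assume P: "P \<subseteq> beyond s N" "infinite P"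
        from P(2) obtain a where "a \<in> P" by fastforce
        then obtain b where b: "b \<in> P" "\<And>a. a \<in> P \<Longrightarrow> b \<le> a"
          using LeastI[of "\<lambda>n. n \<in> P" a] Least_le[of "\<lambda>n. n \<in> P"] by metis
        then have "(s \<union> P) \<inter> {..<b} = s"
          using P(1) by (force simp: beyond_def)
        then show "W (s \<union> P)" using s unfolding W_def by metis
      qed
      then show False
        using rej[of s] fin[OF s] that N unfolding rejects_def by simp
    qed
    then show thesis using that[of N] N M' by (meson order_trans)
  qed
qed

section \<open>Oscillation and independence of sequences\<close>

text \<open>\<open>card (t \<inter> {..<n})\<close> is the position of \<open>n\<close> in
  \<open>t\<close>, counted from 0; a pattern thus starts with a value above
  \<open>s\<close>.\<close>

definition alternates :: "real \<Rightarrow> real \<Rightarrow> (nat \<Rightarrow> real) \<Rightarrow> nat set \<Rightarrow> bool" where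
  "alternates r s \<phi> t \<longleftrightarrow>
     (\<forall>n\<in>t. if even (card (t \<inter> {..<n})) then s < \<phi> n else \<phi> n < r)"

lemma alternating_subset:
  assumes N: "infinite N" and lo: "infinite {n\<in>N. \<phi> n < r}" and hi: "infinite {n\<in>N. s < \<phi> n}"
  obtains P where "P \<subseteq> N" "infinite P" "\<And>k. alternates r s \<phi> (P \<inter> {..<k})"
proof -
  define A where "A n x \<longleftrightarrow> x \<in> N \<and> (if even n then s < \<phi> x else \<phi> x < r)" for n :: nat and x
  have "\<exists>y. A n y \<and> x < y" for n x
  proof -
    have "infinite {y. A n y}"
      using lo hi by (cases "even n") (auto simp: A_def)
    then show ?thesis unfolding infinite_nat_iff_unbounded by auto
  qed
  then obtain p where p: "\<And>n. A n (p n)" "\<And>n. p n < p (Suc n)"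
    using dependent_nat_choice[of A "\<lambda>_. (<)"] by blast
  then have sm: "strict_mono p" by (simp add: strict_mono_Suc_iff)
  show thesis
  proof (rule that)
    show "range p \<subseteq> N" using p(1) by (auto simp: A_def)
    show "infinite (range p)"
      using sm by (simp add: finite_image_iff strict_mono_imp_inj_on)
    fix k
    have "card (range p \<inter> {..<k} \<inter> {..<p i}) = i" if "p i < k" for i
    proof -
      have "range p \<inter> {..<k} \<inter> {..<p i} = p ` {..<i}"
        using that by (auto simp: strict_mono_less[OF sm] intro: less_trans[of _ "p i" k])
      then show ?thesis
        using sm by (simp add: card_image strict_mono_imp_inj_on inj_on_subset)
    qed
    then show "alternates r s \<phi> (range p \<inter> {..<k})"
      using p(1) by (auto simp: alternates_def A_def)
  qed
qed

text \<open>A full sign pattern on the odd-indexed members of \<open>N\<close> is part of an alternating pattern: the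
  even-indexed members serve as fillers that adjust the parity.\<close>

lemma alternating_extends_signs:
  fixes e :: "nat \<Rightarrow> nat"
  assumes e: "strict_mono e"
  shows "\<exists>t\<subseteq>e ` {..<2*m}. \<forall>i<m. e (2*i+1) \<in> t \<and> (even (card (t \<inter> {..<e (2*i+1)})) \<longleftrightarrow> i \<in> I)"
proof (induction m)
  case (Suc m)
  then obtain t where t: "t \<subseteq> e ` {..<2*m}"
    and sgn: "\<And>i. i < m \<Longrightarrow> e (2*i+1) \<in> t \<and> (even (card (t \<inter> {..<e (2*i+1)})) \<longleftrightarrow> i \<in> I)"
    by blast
  define u where "u = (if even (card t) \<longleftrightarrow> m \<in> I then t else insert (e (2*m)) t)"
  define t' where "t' = insert (e (2*m+1)) u"
  have less: "e i < e j \<longleftrightarrow> i < j" for i j using e by (simp add: strict_mono_less)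
  have t_less: "a < e (2*m)" if "a \<in> t" for a using t that less by auto
  have fin: "finite t" using t finite_subset by blast
  have u_less: "a < e (2*m+1)" if "a \<in> u" for a
    using that t_less[of a] less[of "2*m" "2*m+1"] by (auto simp: u_def split: if_splits)
  have card_u: "even (card u) \<longleftrightarrow> m \<in> I"
    using t_less fin by (auto simp: u_def card_insert_if)
  have u: "t \<subseteq> u" "u \<subseteq> insert (e (2*m)) t" by (auto simp: u_def)
  have "e (2*i+1) \<in> t' \<and> (even (card (t' \<inter> {..<e (2*i+1)})) \<longleftrightarrow> i \<in> I)" if i: "i < Suc m" for i
  proof (cases "i = m")
    case True
    have "t' \<inter> {..<e (2*m+1)} = u" using u_less by (auto simp: t'_def)
    then show ?thesis using card_u True by (simp add: t'_def)
  next
    case False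
    then have "i < m" using i by simp
    then have "t' \<inter> {..<e (2*i+1)} = t \<inter> {..<e (2*i+1)}"
      using u less by (auto simp: t'_def)
    then show ?thesis using sgn[OF \<open>i < m\<close>] u by (auto simp: t'_def)
  qed
  moreover have "t' \<subseteq> e ` {..<2 * Suc m}"
    using t u by (fastforce simp: t'_def)
  ultimately show ?case by blast
qed simp

text \<open>Galvin's theorem is applied to the finite sets on which no member of
  \<open>\<Phi>\<close> alternates. On the resulting \<open>M\<close> oscillation gives one \<phi>
  and an infinite \<open>P\<close> all of whose initial segments alternate for it, which rules out
  the second alternative. So every finite subset of \<open>M\<close> alternates for some member of
  \<open>\<Phi>\<close>, and the points at odd indices can be given any signs.\<close>

lemma independent_subsequence:
  fixes \<Phi> :: "(nat \<Rightarrow> real) set"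
  assumes N: "infinite N"
    and osc: "\<And>M. M \<subseteq> N \<Longrightarrow> infinite M \<Longrightarrow>
      \<exists>\<phi>\<in>\<Phi>. infinite {n\<in>M. \<phi> n < r} \<and> infinite {n\<in>M. s < \<phi> n}"
  obtains k :: "nat \<Rightarrow> nat" where "strict_mono k"
    "\<And>I m. \<exists>\<phi>\<in>\<Phi>. \<forall>i<m. if i \<in> I then s < \<phi> (k i) else \<phi> (k i) < r"
proof -
  define \<F> where "\<F> = {t. finite t \<and> \<not> (\<exists>\<phi>\<in>\<Phi>. alternates r s \<phi> t)}"
  obtain M where M: "M \<subseteq> N" "infinite M"
    and alt: "(\<forall>t\<subseteq>M. t \<notin> \<F>) \<or> (\<forall>P\<subseteq>M. infinite P \<longrightarrow> (\<exists>k. P \<inter> {..<k} \<in> \<F>))"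
    by (rule Galvin[of \<F> N]) (use N in \<open>auto simp: \<F>_def\<close>)
  obtain \<phi> where "\<phi> \<in> \<Phi>" "infinite {n\<in>M. \<phi> n < r}" "infinite {n\<in>M. s < \<phi> n}"
    using osc[OF M] by blast
  moreover from this obtain P where "P \<subseteq> M" "infinite P" "\<And>k. alternates r s \<phi> (P \<inter> {..<k})"
    using alternating_subset[OF M(2)] by blast
  ultimately have "\<forall>t\<subseteq>M. t \<notin> \<F>"
    using alt unfolding \<F>_def by blast
  then have *: "\<exists>\<phi>\<in>\<Phi>. alternates r s \<phi> t" if "finite t" "t \<subseteq> M" for t
    using that by (auto simp: \<F>_def)
  define e where "e = enumerate M"
  have e: "strict_mono e" "\<And>n. e n \<in> M"
    using M(2) by (auto simp: e_def strict_mono_def enumerate_mono enumerate_in_set)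
  show thesis
  proof (rule that[of "\<lambda>i. e (2*i+1)"])
    show "strict_mono (\<lambda>i. e (2*i+1))"
      using e(1) by (auto simp: strict_mono_def)
    fix I m
    from alternating_extends_signs[OF e(1), of m I]
    obtain t where t: "t \<subseteq> e ` {..<2*m}"
      "\<And>i. i < m \<Longrightarrow> e (2*i+1) \<in> t \<and> (even (card (t \<inter> {..<e (2*i+1)})) \<longleftrightarrow> i \<in> I)"
      by blast
    moreover from t(1) e(2) have "finite t" "t \<subseteq> M" by (auto intro: finite_subset)
    then obtain \<phi> where "\<phi> \<in> \<Phi>" "alternates r s \<phi> t" using * by blast
    moreover have "if i \<in> I then s < \<phi> (e (2*i+1)) else \<phi> (e (2*i+1)) < r" if "i < m" for i
      using \<open>alternates r s \<phi> t\<close> t(2)[OF that] unfolding alternates_def by auto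
    ultimately show "\<exists>\<phi>\<in>\<Phi>. \<forall>i<m. if i \<in> I then s < \<phi> (e (2*i+1)) else \<phi> (e (2*i+1)) < r"
      by blast
  qed
qed

lemma infinite_of_subsequence:
  fixes k :: "nat \<Rightarrow> nat"
  assumes "strict_mono k" "eventually (\<lambda>n. P (k n)) sequentially"
  shows "infinite {n. P n}"
proof -
  obtain n0 where "\<And>n. n0 \<le> n \<Longrightarrow> P (k n)"
    using assms(2) by (auto simp: eventually_sequentially)
  then have "k ` {n0..} \<subseteq> {n. P n}" by auto
  moreover have "infinite (k ` {n0..})"
    using assms(1) by (simp add: finite_image_iff strict_mono_imp_inj_on inj_on_subset infinite_Ici)
  ultimately show ?thesis using finite_subset by blast
qed

text \<open>A bounded divergent sequence has two different subsequential limits: one from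
  compactness, another from the indices that stay away from the first. The separating thresholds are
  taken rational so that only countably many pairs have to be handled by a diagonal
  argument.\<close>

lemma oscillation_gap:
  fixes u :: "nat \<Rightarrow> real"
  assumes "bounded (range u)" "\<not> convergent u"
  obtains a b :: rat where "a < b" "infinite {n. u n < of_rat a}" "infinite {n. of_rat b < u n}"
proof -
  note result = that
  have sub: "\<exists>l k. strict_mono k \<and> (u \<circ> (h \<circ> k)) \<longlonglongrightarrow> l" for h :: "nat \<Rightarrow> nat"
  proof -
    have "bounded (range (u \<circ> h))" using assms(1) by (rule bounded_subset) auto
    from bounded_imp_convergent_subsequence[OF this] show ?thesis by (auto simp: o_assoc)
  qed
  have gap: thesis if k: "strict_mono k" "(u \<circ> k) \<longlonglongrightarrow> l" and h: "strict_mono h" "(u \<circ> h) \<longlonglongrightarrow> l'"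
    and "l < l'" for k h :: "nat \<Rightarrow> nat" and l l'
  proof -
    obtain a where a: "l < of_rat a" "of_rat a < l'" using of_rat_dense[OF \<open>l < l'\<close>] by blast
    obtain b where b: "real_of_rat a < of_rat b" "of_rat b < l'" using of_rat_dense[OF a(2)] by blast
    show thesis
    proof (rule result)
      show "a < b" using b(1) by (simp add: of_rat_less)
      show "infinite {n. u n < of_rat a}"
        using order_tendstoD(2)[OF k(2) a(1)] by (intro infinite_of_subsequence[OF k(1)]) simp
      show "infinite {n. of_rat b < u n}"
        using order_tendstoD(1)[OF h(2) b(2)] by (intro infinite_of_subsequence[OF h(1)]) simp
    qed
  qed
  obtain l k where k: "strict_mono k" "(u \<circ> k) \<longlonglongrightarrow> l" using sub[of id] by auto
  have "\<not> u \<longlonglongrightarrow> l" using assms(2) by (auto simp: convergent_def)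
  then obtain e where e: "0 < e" "\<not> eventually (\<lambda>n. dist (u n) l < e) sequentially"
    by (auto simp: tendsto_iff)
  then have "infinite {n. e \<le> dist (u n) l}"
    by (auto simp: eventually_sequentially infinite_nat_iff_unbounded_le not_less)
  from infinite_enumerate[OF this] obtain h :: "nat \<Rightarrow> nat" where h: "strict_mono h" "\<And>n. e \<le> dist (u (h n)) l"
    by auto
  obtain l' g where g: "strict_mono g" "(u \<circ> (h \<circ> g)) \<longlonglongrightarrow> l'" using sub[of h] by blast
  have "(\<lambda>n. dist ((u \<circ> (h \<circ> g)) n) l) \<longlonglongrightarrow> dist l' l"
    using g(2) by (intro tendsto_intros)
  then have "e \<le> dist l' l"
    by (rule Lim_bounded2) (use h(2) in auto)
  with e(1) consider "l < l'" | "l' < l" by force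
  then show thesis
    using gap k g h(1) strict_mono_o by metis
qed

text \<open>If, for some pair of rational thresholds, every infinite subset of some infinite
  \<open>M\<close> still shows oscillation of a member of \<open>\<Phi>\<close>, independence
  follows. Otherwise each pair can be made harmless by thinning any infinite set. Diagonalising over
  all pairs leaves a set on which no member of \<open>\<Phi>\<close> oscillates across a rational
  gap, hence each converges.\<close>

lemma convergent_or_independent:
  fixes \<Phi> :: "(nat \<Rightarrow> real) set"
  assumes bdd: "\<And>\<phi>. \<phi> \<in> \<Phi> \<Longrightarrow> bounded (range \<phi>)"
  obtains (convergent) k :: "nat \<Rightarrow> nat" where "strict_mono k" "\<And>\<phi>. \<phi> \<in> \<Phi> \<Longrightarrow> convergent (\<phi> \<circ> k)"
  | (independent) k :: "nat \<Rightarrow> nat" and r s where "strict_mono k" "r < s"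
      "\<And>I m. \<exists>\<phi>\<in>\<Phi>. \<forall>i<m. if i \<in> I then s < \<phi> (k i) else \<phi> (k i) < r"
proof -
  define osc where "osc = (\<lambda>(a, b) (M :: nat set) \<phi>.
      infinite {n\<in>M. \<phi> n < real_of_rat a} \<and> infinite {n\<in>M. real_of_rat b < \<phi> n})"
  define good where "good p M \<longleftrightarrow> (fst p < snd p \<longrightarrow> (\<forall>\<phi>\<in>\<Phi>. \<not> osc p M \<phi>))" for p and M :: "nat set"
  have osc_mono: "osc p M \<phi>" if "osc p N \<phi>" "N \<subseteq> M" for p M N and \<phi> :: "nat \<Rightarrow> real"
  proof -
    obtain a b where p: "p = (a, b)" by fastforce
    have "{n\<in>N. \<phi> n < of_rat a} \<subseteq> {n\<in>M. \<phi> n < of_rat a}" "{n\<in>N. of_rat b < \<phi> n} \<subseteq> {n\<in>M. of_rat b < \<phi> n}"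
      using that(2) by auto
    then show ?thesis
      using that(1) unfolding p osc_def case_prod_conv by (meson infinite_super)
  qed
  then have good_mono: "good p N" if "good p M" "N \<subseteq> M" for p M N
    using that unfolding good_def by blast
  show thesis
  proof (cases "\<exists>p M. fst p < snd p \<and> infinite M \<and> (\<forall>N\<subseteq>M. infinite N \<longrightarrow> \<not> good p N)")
    case True
    then obtain p M where p: "fst p < snd p" and M: "infinite M" "\<And>N. N \<subseteq> M \<Longrightarrow> infinite N \<Longrightarrow> \<not> good p N"
      by blast
    obtain k :: "nat \<Rightarrow> nat" where k: "strict_mono k"
      "\<And>I m. \<exists>\<phi>\<in>\<Phi>. \<forall>i<m. if i \<in> I then real_of_rat (snd p) < \<phi> (k i) else \<phi> (k i) < real_of_rat (fst p)"
    proof (rule independent_subsequence[OF M(1), of \<Phi> "real_of_rat (fst p)" "real_of_rat (snd p)"])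
      fix N assume "N \<subseteq> M" "infinite N"
      then have "\<not> good p N" by (rule M(2))
      then show "\<exists>\<phi>\<in>\<Phi>. infinite {n\<in>N. \<phi> n < real_of_rat (fst p)} \<and> infinite {n\<in>N. real_of_rat (snd p) < \<phi> n}"
        by (auto simp: good_def osc_def split: prod.splits)
    qed blast
    moreover have "real_of_rat (fst p) < real_of_rat (snd p)" using p by (simp add: of_rat_less)
    ultimately show thesis by (intro independent)
  next
    case False
    then have thin: "\<exists>N\<subseteq>M. infinite N \<and> good p N" if "infinite M" for p M
      using that good_def by (cases "fst p < snd p") blast+
    define pr :: "nat \<Rightarrow> rat \<times> rat" where "pr = from_nat"
    \<comment> \<open>Here \<open>fusion\<close> uses a finite set only through its size: a set of
      size \<open>j + 1\<close> secures the pairs numbered \<open>0\<close> to \<open>j\<close>, and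
      the infinite \<open>N\<close> has finite subsets of every size.\<close>
    obtain N where N: "infinite N" and goodN: "\<And>s. finite s \<Longrightarrow> s \<subseteq> N \<Longrightarrow> \<forall>j<card s. good (pr j) N"
    proof (rule fusion[where M = UNIV and Q = "\<lambda>s M. \<forall>j<card s. good (pr j) M"])
      show "\<forall>j<card s. good (pr j) M \<Longrightarrow> N \<subseteq> M \<Longrightarrow> \<forall>j<card s. good (pr j) N" for s M N :: "nat set"
        using good_mono by blast
      have all: "\<exists>N\<subseteq>M. infinite N \<and> (\<forall>j<m. good (pr j) N)" if M: "infinite M" for m and M :: "nat set"
      proof (induction m)
        case 0
        then show ?case using M by blast
      next
        case (Suc m)
        then obtain N where N: "N \<subseteq> M" "infinite N" "\<forall>j<m. good (pr j) N" by blast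
        from thin[OF N(2)] obtain N' where "N' \<subseteq> N" "infinite N'" "good (pr m) N'" by blast
        with N show ?case
          by (intro exI[of _ N']) (auto simp: less_Suc_eq intro: good_mono)
      qed
      then show "infinite M \<Longrightarrow> \<exists>N\<subseteq>M. infinite N \<and> (\<forall>j<card s. good (pr j) N)" for s M :: "nat set"
        by blast
      fix s M :: "nat set"
      assume s: "finite s" and *: "\<forall>j<card s. good (pr j) (beyond s M)"
      have inf: "infinite {n \<in> beyond s M. R n}" if "infinite {n\<in>M. R n}" for R
      proof -
        have "beyond s {n\<in>M. R n} = {n \<in> beyond s M. R n}" by (auto simp: beyond_def)
        then show ?thesis using infinite_beyond[OF s that] by simp
      qed
      have "osc p (beyond s M) \<phi>" if "osc p M \<phi>" for p \<phi>
        using that inf by (auto simp: osc_def split: prod.splits)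
      then have "good p M" if "good p (beyond s M)" for p
        using that unfolding good_def by blast
      with * show "\<forall>j<card s. good (pr j) M" by blast
    qed auto
    have good: "good p N" for p
    proof -
      obtain j where "pr j = p" unfolding pr_def by (metis from_nat_to_nat)
      moreover obtain s where "finite s" "s \<subseteq> N" "card s = Suc j"
        using infinite_arbitrarily_large[OF N] by metis
      ultimately show ?thesis using goodN[of s] by auto
    qed
    define k where "k = enumerate N"
    have k: "strict_mono k" "\<And>n. k n \<in> N"
      using N by (auto simp: k_def strict_mono_def enumerate_mono enumerate_in_set)
    have inf: "infinite {n\<in>N. R n}" if "infinite {n. R (k n)}" for R
    proof -
      have "infinite (k ` {n. R (k n)})"
        using that k(1) by (metis finite_imageD inj_on_subset strict_mono_imp_inj_on subset_UNIV)
      moreover have "k ` {n. R (k n)} \<subseteq> {n\<in>N. R n}" using k(2) by auto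
      ultimately show ?thesis using finite_subset by blast
    qed
    have "convergent (\<phi> \<circ> k)" if \<phi>: "\<phi> \<in> \<Phi>" for \<phi>
    proof (rule ccontr)
      assume "\<not> convergent (\<phi> \<circ> k)"
      moreover have "bounded (range (\<phi> \<circ> k))"
        using bdd[OF \<phi>] by (rule bounded_subset) auto
      ultimately obtain a b where "a < b" "infinite {n. (\<phi> \<circ> k) n < of_rat a}" "infinite {n. of_rat b < (\<phi> \<circ> k) n}"
        using oscillation_gap by blast
      then have "osc (a, b) N \<phi>"
        using inf[of "\<lambda>n. \<phi> n < of_rat a"] inf[of "\<lambda>n. of_rat b < \<phi> n"] by (simp add: osc_def)
      with good[of "(a, b)"] \<phi> \<open>a < b\<close> show False by (auto simp: good_def)
    qed
    then show thesis using k(1) convergent by blast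
  qed
qed

section \<open>Rosenthal's theorem\<close>

lemma summable_l1_scaleR:
  fixes x :: "nat \<Rightarrow> 'a::banach"
  assumes "a \<in> l1" "\<And>n. norm (x n) \<le> B"
  shows "summable (\<lambda>n. norm (a n *\<^sub>R x n))"
proof (rule summable_comparison_test')
  show "summable (\<lambda>n. \<bar>a n\<bar> * B)" using assms(1) by (simp add: l1_def summable_mult2)
  show "norm (norm (a n *\<^sub>R x n)) \<le> \<bar>a n\<bar> * B" for n
    using assms(2) by (simp add: mult_left_mono)
qed

text \<open>The dichotomy is applied to the sequences of values of functionals in the dual unit
  ball. In the independent case finite sign patterns give a lower \<open>\<ell>\<^sub>1\<close>
  estimate, which passes to infinite sums and makes
  \<open>a \<mapsto> \<Sum>n. a n *\<^sub>R y n\<close> an isomorphic embedding.\<close>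

theorem Rosenthal_l1:
  fixes x :: "nat \<Rightarrow> 'a::banach"
  assumes no_l1: "\<not> contains_l1 TYPE('a)" and x: "\<And>n. norm (x n) \<le> B"
  obtains k :: "nat \<Rightarrow> nat" where "strict_mono k" "\<And>f :: 'a \<Rightarrow>\<^sub>L real. convergent (\<lambda>n. f (x (k n)))"
proof -
  define \<Phi> where "\<Phi> = {\<lambda>n. blinfun_apply f (x n) | f :: 'a \<Rightarrow>\<^sub>L real. norm f \<le> 1}"
  have bdd: "bounded (range \<phi>)" if "\<phi> \<in> \<Phi>" for \<phi>
  proof -
    from that obtain f :: "'a \<Rightarrow>\<^sub>L real" where f: "norm f \<le> 1" "\<phi> = (\<lambda>n. blinfun_apply f (x n))"
      by (auto simp: \<Phi>_def)
    have "norm (\<phi> n) \<le> B" for n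
      using norm_blinfun[of f "x n"] f mult_right_mono[OF f(1) norm_ge_zero, of "x n"] x[of n] by simp
    then show ?thesis by (auto simp: bounded_iff)
  qed
  show thesis
  proof (rule convergent_or_independent[OF bdd])
    fix k :: "nat \<Rightarrow> nat"
    assume convergent: "strict_mono k" "\<And>\<phi>. \<phi> \<in> \<Phi> \<Longrightarrow> convergent (\<phi> \<circ> k)"
    have "convergent (\<lambda>n. f (x (k n)))" for f :: "'a \<Rightarrow>\<^sub>L real"
    proof -
      \<comment> \<open>For \<open>f = 0\<close> the convention \<open>inverse 0 = 0\<close> gives
        \<open>g = 0\<close>, and \<open>norm f * g z = f z\<close> still holds.\<close>
      define g where "g = inverse (norm f) *\<^sub>R f"
      have "norm g \<le> 1" by (cases "f = 0") (auto simp: g_def)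
      then have "convergent ((\<lambda>n. blinfun_apply g (x n)) \<circ> k)"
        by (intro convergent(2)) (auto simp: \<Phi>_def)
      then have "convergent (\<lambda>n. norm f * blinfun_apply g (x (k n)))"
        by (intro convergent_mult) (auto simp: o_def convergent_const)
      moreover have "norm f * blinfun_apply g z = blinfun_apply f z" for z
        by (cases "f = 0") (auto simp: g_def blinfun.scaleR_left)
      ultimately show ?thesis by simp
    qed
    then show thesis using that convergent(1) by blast
  next
    fix k :: "nat \<Rightarrow> nat" and r s :: real
    assume independent: "strict_mono k" "r < s"
      "\<And>I m. \<exists>\<phi>\<in>\<Phi>. \<forall>i<m. if i \<in> I then s < \<phi> (k i) else \<phi> (k i) < r"
    define y where "y n = x (k n)" for n
    have y: "norm (y n) \<le> B" for n using x by (simp add: y_def)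
    have lower: "(s - r) / 2 * (\<Sum>n<m. \<bar>a n\<bar>) \<le> norm (\<Sum>n<m. a n *\<^sub>R y n)" for a m
    proof -
      obtain f :: "'a \<Rightarrow>\<^sub>L real" where f: "norm f \<le> 1"
        "\<And>i. i < m \<Longrightarrow> if 0 \<le> a i then s < f (y i) else f (y i) < r"
        using independent(3)[of m "{i. 0 \<le> a i}"] by (auto simp: \<Phi>_def y_def)
      \<comment> \<open>\<open>g\<close> realises the pattern opposite to that of \<open>f\<close>.
        The difference \<open>f - g\<close> follows the signs of \<open>a\<close> with margin
        \<open>s - r\<close> even if \<open>r\<close> and \<open>s\<close> lie on the same side of
        0. Its norm is at most 2, whence the constant \<open>(s - r) / 2\<close>.\<close>
      obtain g :: "'a \<Rightarrow>\<^sub>L real" where g: "norm g \<le> 1"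
        "\<And>i. i < m \<Longrightarrow> if a i < 0 then s < g (y i) else g (y i) < r"
        using independent(3)[of m "{i. a i < 0}"] by (auto simp: \<Phi>_def y_def)
      have "(s - r) * \<bar>a n\<bar> \<le> a n * (f - g) (y n)" if "n < m" for n
      proof (cases "0 \<le> a n")
        case True
        then show ?thesis
          using f(2)[OF that] g(2)[OF that] mult_left_mono[of "s - r" "(f - g) (y n)" "a n"]
          by (simp add: blinfun.diff_left mult.commute)
      next
        case False
        then show ?thesis
          using f(2)[OF that] g(2)[OF that] mult_left_mono_neg[of "(f - g) (y n)" "r - s" "a n"]
          by (simp add: blinfun.diff_left algebra_simps)
      qed
      then have "(s - r) * (\<Sum>n<m. \<bar>a n\<bar>) \<le> (\<Sum>n<m. a n * (f - g) (y n))"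
        unfolding sum_distrib_left by (intro sum_mono) auto
      also have "\<dots> = (f - g) (\<Sum>n<m. a n *\<^sub>R y n)"
        by (simp add: blinfun.sum_right blinfun.scaleR_right)
      also have "\<dots> \<le> norm (f - g) * norm (\<Sum>n<m. a n *\<^sub>R y n)"
        using norm_blinfun[of "f - g" "\<Sum>n<m. a n *\<^sub>R y n"] by (simp only: real_norm_def abs_le_iff)
      also have "\<dots> \<le> 2 * norm (\<Sum>n<m. a n *\<^sub>R y n)"
        using norm_triangle_ineq4[of f g] f(1) g(1) by (intro mult_right_mono) auto
      finally show ?thesis by simp
    qed
    define J where "J a = (\<Sum>n. a n *\<^sub>R y n)" for a
    have summ: "summable (\<lambda>n. norm (a n *\<^sub>R y n))" if "a \<in> l1" for a
      using summable_l1_scaleR[OF that y] .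
    have summ': "summable (\<lambda>n. a n *\<^sub>R y n)" if "a \<in> l1" for a
      using summ[OF that] by (rule summable_norm_cancel)
    have "(s - r) / 2 * l1_norm a \<le> norm (J a)" if a: "a \<in> l1" for a
    proof (rule LIMSEQ_le)
      show "(\<lambda>m. (s - r) / 2 * (\<Sum>n<m. \<bar>a n\<bar>)) \<longlonglongrightarrow> (s - r) / 2 * l1_norm a"
        using a unfolding l1_norm_def l1_def by (intro tendsto_intros summable_LIMSEQ) simp
      show "(\<lambda>m. norm (\<Sum>n<m. a n *\<^sub>R y n)) \<longlonglongrightarrow> norm (J a)"
        using summ'[OF a] unfolding J_def by (intro tendsto_intros summable_LIMSEQ)
    qed (use lower in blast)
    moreover have "norm (J a) \<le> B * l1_norm a" if a: "a \<in> l1" for a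
    proof -
      have "norm (J a) \<le> (\<Sum>n. norm (a n *\<^sub>R y n))"
        unfolding J_def by (rule summable_norm[OF summ[OF a]])
      also have "\<dots> \<le> (\<Sum>n. B * \<bar>a n\<bar>)"
        using a y by (intro suminf_le summ summable_mult) (auto simp: l1_def mult.commute[of B] mult_left_mono)
      finally show ?thesis
        using a by (simp add: l1_norm_def l1_def suminf_mult)
    qed
    moreover have "J (\<lambda>n. a n + b n) = J a + J b" if "a \<in> l1" "b \<in> l1" for a b
      using that suminf_add[OF summ' summ'] by (simp add: J_def scaleR_add_left)
    moreover have "J (\<lambda>n. t * a n) = t *\<^sub>R J a" if "a \<in> l1" for a t
      using suminf_scaleR_right[OF summ'[OF that], of t] by (simp add: J_def)
    ultimately have "contains_l1 TYPE('a)"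
      unfolding contains_l1_def using \<open>r < s\<close>
      by (intro exI[of _ J] exI[of _ "(s - r) / 2"] exI[of _ B]) auto
    with no_l1 show thesis by contradiction
  qed
qed

section \<open>The Mackey topology on the dual\<close>

lemma continuous_map_weak_topologyI:
  fixes g :: "'b \<Rightarrow> 'a::real_normed_vector"
  assumes "\<And>f :: 'a \<Rightarrow>\<^sub>L real. continuous_map T euclideanreal (\<lambda>t. f (g t))"
  shows "continuous_map T weak_topology g"
  unfolding weak_topology_def
  by (rule continuous_map_pullback') (auto simp: o_def continuous_map_componentwise_UNIV assms)

lemma continuous_map_weak_topology_apply:
  "continuous_map weak_topology euclideanreal (blinfun_apply f)"
proof -
  have "continuous_map weak_topology euclideanreal ((\<lambda>h. h f) \<circ> (\<lambda>x (f::'a \<Rightarrow>\<^sub>L real). blinfun_apply f x))"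
    unfolding weak_topology_def
    by (intro continuous_map_pullback continuous_map_product_projection) auto
  then show ?thesis by (simp add: o_def)
qed

definition weakly_null :: "(nat \<Rightarrow> 'a::real_normed_vector) \<Rightarrow> bool" where
  "weakly_null y \<longleftrightarrow> (\<forall>f :: 'a \<Rightarrow>\<^sub>L real. (\<lambda>n. f (y n)) \<longlonglongrightarrow> 0)"

text \<open>The closed unit ball of \<open>\<ell>\<^sub>1\<close>. Bounding partial sums makes it an
  intersection of sets that are closed for coordinatewise convergence; summability follows.\<close>

definition l1_ball :: "(nat \<Rightarrow> real) set" where
  "l1_ball = {a. \<forall>m. (\<Sum>n<m. \<bar>a n\<bar>) \<le> 1}"

lemma l1_ball_l1: "l1_ball \<subseteq> l1"
proof
  fix a assume "a \<in> l1_ball"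
  then show "a \<in> l1"
    unfolding l1_ball_def l1_def by (auto intro!: summableI_nonneg_bounded[of _ 1])
qed

text \<open>By Tychonoff's theorem, as a closed subset of the cube with sides
  \<open>{-1..1}\<close>; the topology of \<open>nat \<Rightarrow> real\<close> is the product
  topology.\<close>

lemma compact_l1_ball: "compact l1_ball"
proof -
  have "compactin (product_topology (\<lambda>_::nat. euclideanreal) UNIV) (PiE UNIV (\<lambda>_. {-1..1}))"
    by (simp add: compactin_PiE)
  then have "compact (PiE UNIV (\<lambda>_::nat. {-1..1::real}))"
    by (simp add: euclidean_product_topology)
  moreover have "closed l1_ball"
  proof -
    have "l1_ball = (\<Inter>m. {a. (\<Sum>n<m. \<bar>a n\<bar>) \<le> 1})" by (auto simp: l1_ball_def)
    moreover have "closed {a :: nat \<Rightarrow> real. (\<Sum>n<m. \<bar>a n\<bar>) \<le> 1}" for m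
      by (intro closed_Collect_le continuous_intros continuous_on_product_coordinates)
    ultimately show ?thesis by (metis closed_INT)
  qed
  moreover have "l1_ball \<subseteq> PiE UNIV (\<lambda>_. {-1..1})"
  proof
    fix a assume a: "a \<in> l1_ball"
    have "\<bar>a i\<bar> \<le> 1" for i
    proof -
      have "\<bar>a i\<bar> \<le> (\<Sum>n<Suc i. \<bar>a n\<bar>)" by (rule member_le_sum) auto
      also have "\<dots> \<le> 1" using a by (simp only: l1_ball_def mem_Collect_eq)
      finally show ?thesis .
    qed
    then show "a \<in> PiE UNIV (\<lambda>_. {-1..1})" by (auto simp: abs_le_iff minus_le_iff)
  qed
  ultimately show ?thesis by (metis compact_Int_closed inf.absorb_iff2)
qed

text \<open>Partial sums depend on finitely many coordinates. The tail from \<open>m\<close> on is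
  at most the supremum of \<open>\<bar>b n\<bar>\<close> over \<open>n \<ge> m\<close>, uniformly in
  \<open>a\<close>, so the limit is uniform on the ball.\<close>

lemma continuous_on_l1_ball_pairing:
  fixes b :: "nat \<Rightarrow> real"
  assumes "b \<longlonglongrightarrow> 0"
  shows "continuous_on l1_ball (\<lambda>a. \<Sum>n. a n * b n)"
proof (rule uniform_limit_theorem)
  show "\<forall>\<^sub>F m in sequentially. continuous_on l1_ball (\<lambda>a. \<Sum>n<m. a n * b n)"
    by (intro always_eventually allI continuous_intros
        continuous_on_subset[OF continuous_on_product_coordinates subset_UNIV])
  show "uniform_limit l1_ball (\<lambda>m a. \<Sum>n<m. a n * b n) (\<lambda>a. \<Sum>n. a n * b n) sequentially"
  proof (rule uniform_limitI)
    fix e :: real assume e: "0 < e"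
    then have "\<forall>\<^sub>F n in sequentially. \<bar>b n\<bar> < e / 2"
      using assms by (auto simp: tendsto_iff dist_real_def dest: spec[of _ "e / 2"])
    then obtain m0 where m0: "\<And>n. m0 \<le> n \<Longrightarrow> \<bar>b n\<bar> < e / 2"
      by (auto simp: eventually_sequentially)
    have "dist (\<Sum>n<m. a n * b n) (\<Sum>n. a n * b n) < e" if m: "m0 \<le> m" and a: "a \<in> l1_ball" for m a
    proof -
      have sa: "summable (\<lambda>n. \<bar>a n\<bar>)" using a l1_ball_l1 by (auto simp: l1_def)
      have sa': "summable (\<lambda>n. \<bar>a (n + m)\<bar>)" using sa summable_iff_shift[of "\<lambda>n. \<bar>a n\<bar>" m] by simp
      have le: "\<bar>a (n + m) * b (n + m)\<bar> \<le> e / 2 * \<bar>a (n + m)\<bar>" for n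
        using mult_right_mono[of "\<bar>b (n + m)\<bar>" "e / 2" "\<bar>a (n + m)\<bar>"] m0[of "n + m"] m
        by (simp add: abs_mult mult.commute[of "\<bar>a (n + m)\<bar>"])
      have s_tail: "summable (\<lambda>n. \<bar>a (n + m) * b (n + m)\<bar>)"
        by (rule summable_comparison_test'[OF summable_mult[OF sa', of "e / 2"]]) (use le in simp)
      then have "summable (\<lambda>n. a (n + m) * b (n + m))" by (rule summable_rabs_cancel)
      then have s: "summable (\<lambda>n. a n * b n)"
        using summable_iff_shift[of "\<lambda>n. a n * b n" m] by simp
      have tail1: "(\<Sum>n. \<bar>a (n + m)\<bar>) \<le> 1"
      proof -
        have "(\<Sum>n. \<bar>a n\<bar>) \<le> 1"
          using a sa by (intro suminf_le_const) (auto simp: l1_ball_def)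
        moreover have "(\<Sum>n. \<bar>a n\<bar>) = (\<Sum>n. \<bar>a (n + m)\<bar>) + (\<Sum>n<m. \<bar>a n\<bar>)"
          by (rule suminf_split_initial_segment[OF sa])
        moreover have "0 \<le> (\<Sum>n<m. \<bar>a n\<bar>)" by (simp add: sum_nonneg)
        ultimately show ?thesis by linarith
      qed
      have "dist (\<Sum>n<m. a n * b n) (\<Sum>n. a n * b n) = \<bar>\<Sum>n. a (n + m) * b (n + m)\<bar>"
        using suminf_split_initial_segment[OF s, of m] by (simp add: dist_real_def)
      also have "\<dots> \<le> (\<Sum>n. \<bar>a (n + m) * b (n + m)\<bar>)"
        by (rule summable_rabs[OF s_tail])
      also have "\<dots> \<le> (\<Sum>n. e / 2 * \<bar>a (n + m)\<bar>)"
        by (rule suminf_le[OF le s_tail summable_mult[OF sa']])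
      also have "\<dots> = e / 2 * (\<Sum>n. \<bar>a (n + m)\<bar>)" by (rule suminf_mult[OF sa'])
      also have "\<dots> \<le> e / 2 * 1" using tail1 e by (intro mult_left_mono) auto
      finally show ?thesis using e by simp
    qed
    then show "\<forall>\<^sub>F m in sequentially. \<forall>a\<in>l1_ball. dist (\<Sum>n<m. a n * b n) (\<Sum>n. a n * b n) < e"
      unfolding eventually_sequentially by blast
  qed
qed simp

text \<open>Coordinatewise convergence on the \<open>\<ell>\<^sub>1\<close> ball is the weak* topology of \<open>c\<^sub>0\<^sup>* = \<ell>\<^sub>1\<close>, for which
  \<open>a \<mapsto> \<Sum>n. a n *\<^sub>R y n\<close> is continuous into the weak topology.\<close>

lemma weakly_null_in_weakly_compact_disc:
  fixes y :: "nat \<Rightarrow> 'a::banach"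
  assumes y: "weakly_null y" and B: "\<And>n. norm (y n) \<le> B"
  obtains K where "compactin weak_topology K" "convex K" "circled K" "range y \<subseteq> K"
proof -
  define J where "J a = (\<Sum>n. a n *\<^sub>R y n)" for a
  have summ: "summable (\<lambda>n. a n *\<^sub>R y n)" if "a \<in> l1_ball" for a
    using summable_l1_scaleR[OF subsetD[OF l1_ball_l1 that] B] by (rule summable_norm_cancel)
  show thesis
  proof (rule that)
    have "continuous_map (top_of_set l1_ball) weak_topology J"
    proof (rule continuous_map_weak_topologyI)
      fix f :: "'a \<Rightarrow>\<^sub>L real"
      have "blinfun_apply f (J a) = (\<Sum>n. a n * blinfun_apply f (y n))" if "a \<in> l1_ball" for a
        unfolding J_def bounded_linear.suminf[OF blinfun.bounded_linear_right summ[OF that]]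
        by (simp add: blinfun.scaleR_right)
      then have "continuous_on l1_ball (\<lambda>a. f (J a))"
        using continuous_on_l1_ball_pairing[of "\<lambda>n. f (y n)"] y
        by (auto simp: weakly_null_def cong: continuous_on_cong)
      then show "continuous_map (top_of_set l1_ball) euclideanreal (\<lambda>a. f (J a))"
        by simp
    qed
    moreover have "compactin (top_of_set l1_ball) l1_ball"
      using compact_l1_ball by (simp add: compactin_subtopology)
    ultimately show "compactin weak_topology (J ` l1_ball)"
      by (rule image_compactin[rotated])
    \<comment> \<open>One estimate serves twice: \<open>u + v = 1\<close> with nonnegative weights
      gives convexity, \<open>v = 0\<close> gives circledness.\<close>
    have comb: "u *\<^sub>R J a + v *\<^sub>R J b \<in> J ` l1_ball" if "a \<in> l1_ball" "b \<in> l1_ball" "\<bar>u\<bar> + \<bar>v\<bar> \<le> 1" for a b u v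
    proof
      show "u *\<^sub>R J a + v *\<^sub>R J b = J (\<lambda>n. u * a n + v * b n)"
        using suminf_add[OF summable_scaleR_right[OF summ[OF that(1)], of u] summable_scaleR_right[OF summ[OF that(2)], of v]]
          suminf_scaleR_right[OF summ[OF that(1)], of u] suminf_scaleR_right[OF summ[OF that(2)], of v]
        by (simp add: J_def scaleR_add_left)
      have "(\<Sum>n<m. \<bar>u * a n + v * b n\<bar>) \<le> 1" for m
      proof -
        have "(\<Sum>n<m. \<bar>u * a n + v * b n\<bar>) \<le> (\<Sum>n<m. \<bar>u\<bar> * \<bar>a n\<bar> + \<bar>v\<bar> * \<bar>b n\<bar>)"
          by (intro sum_mono) (metis abs_mult abs_triangle_ineq)
        also have "\<dots> = \<bar>u\<bar> * (\<Sum>n<m. \<bar>a n\<bar>) + \<bar>v\<bar> * (\<Sum>n<m. \<bar>b n\<bar>)"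
          by (simp add: sum.distrib sum_distrib_left)
        also have "\<dots> \<le> \<bar>u\<bar> * 1 + \<bar>v\<bar> * 1"
          using that(1,2) by (intro add_mono mult_left_mono) (auto simp: l1_ball_def)
        finally show ?thesis using that(3) by simp
      qed
      then show "(\<lambda>n. u * a n + v * b n) \<in> l1_ball" by (simp add: l1_ball_def)
    qed
    show "convex (J ` l1_ball)"
      unfolding convex_def using comb by auto
    show "circled (J ` l1_ball)"
      unfolding circled_def using comb[where v = 0] by auto
    show "range y \<subseteq> J ` l1_ball"
    proof safe
      fix i :: nat
      have "(\<Sum>n<m. \<bar>if n = i then 1 else 0 :: real\<bar>) \<le> 1" for m
      proof -
        have "(\<Sum>n<m. \<bar>if n = i then 1 else 0 :: real\<bar>) = (\<Sum>n<m. if n = i then 1 else 0)"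
          by (intro sum.cong) auto
        then show ?thesis by (simp add: sum.delta)
      qed
      then have "(\<lambda>n. if n = i then 1 else 0) \<in> l1_ball" by (simp add: l1_ball_def)
      moreover have "J (\<lambda>n. if n = i then 1 else 0) = (\<Sum>n\<in>{i}. (if n = i then 1 else 0 :: real) *\<^sub>R y n)"
        unfolding J_def by (rule suminf_finite) auto
      ultimately show "y i \<in> J ` l1_ball" by (intro image_eqI) auto
    qed
  qed
qed

text \<open>The point is put into the weakly null sequence \<open>z, 0, 0, ...\<close>. Through this
  lemma Mackey neighbourhoods control the value at any given point.\<close>

lemma point_in_weakly_compact_disc:
  fixes z :: "'a::banach"
  obtains K where "compactin weak_topology K" "convex K" "circled K" "z \<in> K"
proof -
  define y where "y n = (if n = 0 then z else 0)" for n :: nat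
  have "weakly_null y"
    unfolding weakly_null_def
  proof
    fix f :: "'a \<Rightarrow>\<^sub>L real"
    have "\<forall>\<^sub>F n in sequentially. f (y n) = 0"
      unfolding eventually_sequentially y_def by (intro exI[of _ 1]) auto
    then show "(\<lambda>n. f (y n)) \<longlonglongrightarrow> 0" by (rule tendsto_eventually)
  qed
  moreover have "norm (y n) \<le> norm z" for n by (simp add: y_def)
  ultimately obtain K where "compactin weak_topology K" "convex K" "circled K" "range y \<subseteq> K"
    using weakly_null_in_weakly_compact_disc by blast
  moreover from this have "y 0 \<in> K" by blast
  ultimately show thesis using that by (simp add: y_def)
qed

text \<open>Uniform boundedness for the evaluations at points of \<open>K\<close>, as functionals on
  the Banach space \<open>X^*\<close>; norming functionals carry the bound back to
  \<open>X\<close>.\<close>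

lemma weakly_compact_imp_bounded:
  fixes K :: "'a::banach set"
  assumes "compactin weak_topology K"
  obtains M where "0 < M" "\<And>x. x \<in> K \<Longrightarrow> norm x \<le> M"
proof -
  define ev where "ev x = Blinfun (\<lambda>f :: 'a \<Rightarrow>\<^sub>L real. blinfun_apply f x)" for x
  have ev: "blinfun_apply (ev x) f = blinfun_apply f x" for x f
    unfolding ev_def by (simp add: bounded_linear_Blinfun_apply blinfun.bounded_linear_left)
  have "\<exists>M. \<forall>z\<in>ev ` K. norm (blinfun_apply z f) \<le> M" for f
  proof -
    have "compact (blinfun_apply f ` K)"
      using image_compactin[OF assms continuous_map_weak_topology_apply] by simp
    then have "bounded (blinfun_apply f ` K)" by (rule compact_imp_bounded)
    then show ?thesis by (auto simp: bounded_iff ev)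
  qed
  then obtain M where M: "0 < M" "\<And>z. z \<in> ev ` K \<Longrightarrow> norm z \<le> M"
    by (rule uniform_boundedness) blast
  have "norm x \<le> M" if "x \<in> K" for x
  proof -
    obtain f :: "'a \<Rightarrow>\<^sub>L real" where f: "norm f \<le> 1" "f x = norm x"
      by (rule norming_functional)
    have "norm x \<le> norm (ev x f)" using f(2) by (simp add: ev)
    also have "\<dots> \<le> norm (ev x) * norm f" by (rule norm_blinfun)
    also have "\<dots> \<le> M * 1" using M f(1) that by (intro mult_mono) auto
    finally show ?thesis by simp
  qed
  with M(1) show thesis by (rule that)
qed

section \<open>Mackey neighbourhoods and weakly null sequences\<close>

text \<open>The members of a local base need not be open, so open sets are provided here. A uniform
  bound \<open>d\<close> strictly below \<open>e\<close> leaves each member a margin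
  \<open>e - d\<close>, whether or not suprema over \<open>K\<close> are attained.\<close>

lemma openin_mackey_nhd:
  fixes l :: "'a::real_normed_vector \<Rightarrow>\<^sub>L real"
  assumes K: "compactin weak_topology K" "convex K" "circled K"
  shows "openin mackey_topology {f :: 'a \<Rightarrow>\<^sub>L real. \<exists>d<e. \<forall>x\<in>K. \<bar>f x - l x\<bar> \<le> d}"
  unfolding mackey_topology_def openin_uniform_convergence_topology
proof
  fix f assume "f \<in> {f :: 'a \<Rightarrow>\<^sub>L real. \<exists>d<e. \<forall>x\<in>K. \<bar>f x - l x\<bar> \<le> d}"
  then obtain d where d: "d < e" "\<And>x. x \<in> K \<Longrightarrow> \<bar>f x - l x\<bar> \<le> d" by auto
  define V where "V = {g :: 'a \<Rightarrow>\<^sub>L real. \<forall>K\<in>{K}. \<forall>x\<in>K. \<bar>g x\<bar> < (e - d) / 2}"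
  have "V \<in> uniform_nhds_0 {K. compactin weak_topology K \<and> convex K \<and> circled K}"
    unfolding uniform_nhds_0_def V_def using K d(1)
    by (intro CollectI exI[of _ "{K}"] exI[of _ "(e - d) / 2"]) auto
  moreover have "(\<lambda>g. f + g) ` V \<subseteq> {f :: 'a \<Rightarrow>\<^sub>L real. \<exists>d<e. \<forall>x\<in>K. \<bar>f x - l x\<bar> \<le> d}"
  proof safe
    fix g assume g: "g \<in> V"
    have "\<bar>(f + g) x - l x\<bar> \<le> (d + e) / 2" if "x \<in> K" for x
    proof -
      have "\<bar>g x\<bar> < (e - d) / 2" using g that by (auto simp: V_def)
      with d(2)[OF that] abs_triangle_ineq[of "f x - l x" "g x"] show ?thesis
        unfolding blinfun.add_left by (simp add: field_simps)
    qed
    moreover have "(d + e) / 2 < e" using d(1) by simp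
    ultimately show "\<exists>d<e. \<forall>x\<in>K. \<bar>(f + g) x - l x\<bar> \<le> d" by blast
  qed
  ultimately show "\<exists>V\<in>uniform_nhds_0 {K. compactin weak_topology K \<and> convex K \<and> circled K}.
      (\<lambda>g. f + g) ` V \<subseteq> {f :: 'a \<Rightarrow>\<^sub>L real. \<exists>d<e. \<forall>x\<in>K. \<bar>f x - l x\<bar> \<le> d}" by blast
qed

text \<open>A basic Mackey neighbourhood involves finitely many weakly compact sets, which have a
  common norm bound.\<close>

lemma mackey_coarser_norm:
  "mackey_topology \<preceq> (dual_norm_topology :: ('a::banach \<Rightarrow>\<^sub>L real) topology)"
  unfolding coarser_def dual_norm_topology_def open_openin[symmetric]
proof (intro allI impI)
  fix U :: "('a \<Rightarrow>\<^sub>L real) set"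
  assume U: "openin mackey_topology U"
  show "open U"
    unfolding open_contains_ball
  proof
    fix f assume "f \<in> U"
    with U obtain V where V: "V \<in> uniform_nhds_0 {K. compactin weak_topology K \<and> convex K \<and> circled K}"
      "(\<lambda>g. f + g) ` V \<subseteq> U"
      unfolding mackey_topology_def openin_uniform_convergence_topology by blast
    from V(1) obtain \<F> e where \<F>: "finite \<F>" "0 < e" "V = {f. \<forall>K\<in>\<F>. \<forall>x\<in>K. \<bar>blinfun_apply f x\<bar> < e}"
      and sub: "\<F> \<subseteq> {K. compactin weak_topology K \<and> convex K \<and> circled K}"
      unfolding uniform_nhds_0_def by blast
    from sub have K: "\<And>K. K \<in> \<F> \<Longrightarrow> compactin weak_topology K" by blast
    have "\<exists>M>0. \<forall>x\<in>K. norm x \<le> M" if "K \<in> \<F>" for K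
      using weakly_compact_imp_bounded[OF K[OF that]] by metis
    then obtain M where M: "\<And>K. K \<in> \<F> \<Longrightarrow> 0 < M K" "\<And>K x. K \<in> \<F> \<Longrightarrow> x \<in> K \<Longrightarrow> norm x \<le> M K"
      by metis
    \<comment> \<open>The summand 1 keeps \<open>N\<close> positive when \<open>\<F>\<close> is
      empty.\<close>
    define N where "N = 1 + sum M \<F>"
    have N: "0 < N" "\<And>K. K \<in> \<F> \<Longrightarrow> M K \<le> N"
      using M(1) \<F>(1) member_le_sum[of _ \<F> M] by (force simp: N_def less_imp_le intro: add_pos_nonneg sum_nonneg)+
    have "g \<in> U" if "dist f g < e / N" for g
    proof -
      have "\<bar>(g - f) x\<bar> < e" if "K \<in> \<F>" "x \<in> K" for K x
      proof -
        have "norm ((g - f) x) \<le> norm (g - f) * norm x" by (rule norm_blinfun)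
        also have "\<dots> \<le> norm (g - f) * N"
          using M(2)[OF that] N(2)[OF that(1)] by (intro mult_left_mono) auto
        also have "\<dots> < e / N * N"
          using \<open>dist f g < e / N\<close> N(1) by (intro mult_strict_right_mono) (auto simp: dist_norm norm_minus_commute)
        finally show ?thesis using N(1) by simp
      qed
      then have "f + (g - f) \<in> U" using V(2) \<F>(3) by blast
      then show ?thesis by simp
    qed
    then show "\<exists>e>0. ball f e \<subseteq> U"
      using N(1) \<F>(2) by (intro exI[of _ "e / N"]) auto
  qed
qed

text \<open>Uniform convergence to 0 on \<open>A\<close> of bounded weakly null sequences; this is what precompact sets
  and convergent sequences of the Mackey topology have in common.\<close>

definition L_set :: "('a::real_normed_vector \<Rightarrow>\<^sub>L real) set \<Rightarrow> bool" where
  "L_set A \<longleftrightarrow> (\<forall>y B e. weakly_null y \<longrightarrow> (\<forall>n. norm (y n) \<le> B) \<longrightarrow> 0 < e \<longrightarrow>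
     (\<forall>\<^sub>F n in sequentially. \<forall>f\<in>A. \<bar>f (y n)\<bar> \<le> e))"

lemma precompact_inE:
  assumes "precompact_in T A" "openin T U" "0 \<in> U"
  obtains F where "finite F" "A \<subseteq> (\<Union>a\<in>F. (\<lambda>u. a + u) ` U)"
  using assms unfolding precompact_in_def by blast

text \<open>The weakly null sequence lies in a disc \<open>K\<close>, whose Mackey neighbourhood
  covers \<open>A\<close> by finitely many translates, with error below \<open>e / 2\<close> on
  \<open>K\<close>. The finitely many centres tend to 0 along the sequence.\<close>

lemma L_set_precompact:
  fixes A :: "('a::banach \<Rightarrow>\<^sub>L real) set"
  assumes A: "precompact_in mackey_topology A"
  shows "L_set A"
  unfolding L_set_def
proof (intro allI impI)
  fix y :: "nat \<Rightarrow> 'a" and B e :: real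
  assume y: "weakly_null y" "\<forall>n. norm (y n) \<le> B" and e: "0 < e"
  obtain K where K: "compactin weak_topology K" "convex K" "circled K" "range y \<subseteq> K"
    using weakly_null_in_weakly_compact_disc y by metis
  define U where "U = {f :: 'a \<Rightarrow>\<^sub>L real. \<exists>d<e/2. \<forall>x\<in>K. \<bar>f x - blinfun_apply 0 x\<bar> \<le> d}"
  have "openin mackey_topology U"
    unfolding U_def by (rule openin_mackey_nhd[OF K(1-3)])
  moreover have "0 \<in> U" using e by (auto simp: U_def intro!: exI[of _ 0])
  ultimately obtain F where F: "finite F" "A \<subseteq> (\<Union>a\<in>F. (\<lambda>u. a + u) ` U)"
    by (rule precompact_inE[OF A])
  have "\<forall>\<^sub>F n in sequentially. \<bar>g (y n)\<bar> < e / 2" for g :: "'a \<Rightarrow>\<^sub>L real"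
    using tendstoD[of "\<lambda>n. g (y n)" 0 _ "e / 2"] y(1) e by (simp add: weakly_null_def)
  then have "\<forall>\<^sub>F n in sequentially. \<forall>g\<in>F. \<bar>g (y n)\<bar> < e / 2"
    using F(1) by (simp add: eventually_ball_finite)
  then show "\<forall>\<^sub>F n in sequentially. \<forall>f\<in>A. \<bar>f (y n)\<bar> \<le> e"
  proof eventually_elim
    case (elim n)
    show ?case
    proof
      fix f assume "f \<in> A"
      with F(2) obtain g u where g: "g \<in> F" "u \<in> U" "f = g + u" by blast
      from g(2) obtain d where d: "d < e / 2" "\<And>x. x \<in> K \<Longrightarrow> \<bar>u x\<bar> \<le> d" by (auto simp: U_def)
      have "\<bar>u (y n)\<bar> \<le> d" using d(2) K(4) by blast
      moreover have "\<bar>g (y n)\<bar> < e / 2" using elim g(1) by blast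
      moreover have "\<bar>f (y n)\<bar> \<le> \<bar>g (y n)\<bar> + \<bar>u (y n)\<bar>"
        unfolding g(3) blinfun.add_left by (rule abs_triangle_ineq)
      ultimately show "\<bar>f (y n)\<bar> \<le> e" using d(1) by linarith
    qed
  qed
qed

lemma eventually_uniform_of_limitin_mackey:
  fixes f :: "nat \<Rightarrow> 'a::real_normed_vector \<Rightarrow>\<^sub>L real"
  assumes lim: "limitin mackey_topology f l sequentially" and e: "0 < e"
    and K: "compactin weak_topology K" "convex K" "circled K"
  shows "\<forall>\<^sub>F n in sequentially. \<forall>x\<in>K. \<bar>(f n - l) x\<bar> \<le> e"
proof -
  define U where "U = {g :: 'a \<Rightarrow>\<^sub>L real. \<exists>d<e. \<forall>x\<in>K. \<bar>g x - l x\<bar> \<le> d}"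
  have "l \<in> U" using e by (auto simp: U_def)
  then have "\<forall>\<^sub>F n in sequentially. f n \<in> U"
    using lim openin_mackey_nhd[OF K, of e l] unfolding limitin_def U_def by blast
  then show ?thesis
    by eventually_elim (force simp: U_def blinfun.diff_left)
qed

text \<open>A disc containing the weakly null sequence controls all \<open>f n - l\<close> with
  \<open>n \<ge> N\<close> at once; the finitely many earlier ones tend to 0 along it
  individually.\<close>

lemma L_set_limitin:
  fixes f :: "nat \<Rightarrow> 'a::banach \<Rightarrow>\<^sub>L real"
  assumes lim: "limitin mackey_topology f l sequentially"
  shows "L_set (range (\<lambda>n. f n - l))"
  unfolding L_set_def
proof (intro allI impI)
  fix y :: "nat \<Rightarrow> 'a" and B e :: real
  assume y: "weakly_null y" "\<forall>n. norm (y n) \<le> B" and e: "0 < e"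
  obtain K where K: "compactin weak_topology K" "convex K" "circled K" "range y \<subseteq> K"
    using weakly_null_in_weakly_compact_disc y by metis
  obtain N where N: "\<And>n x. N \<le> n \<Longrightarrow> x \<in> K \<Longrightarrow> \<bar>(f n - l) x\<bar> \<le> e"
    using eventually_uniform_of_limitin_mackey[OF lim e K(1-3)] by (auto simp: eventually_sequentially)
  have "\<forall>\<^sub>F i in sequentially. \<bar>g (y i)\<bar> < e" for g :: "'a \<Rightarrow>\<^sub>L real"
    using tendstoD[of "\<lambda>n. g (y n)" 0 _ e] y(1) e by (simp add: weakly_null_def)
  then have "\<forall>\<^sub>F i in sequentially. \<forall>n\<in>{..<N}. \<bar>(f n - l) (y i)\<bar> < e"
    by (intro eventually_ball_finite) auto
  then show "\<forall>\<^sub>F i in sequentially. \<forall>g\<in>range (\<lambda>n. f n - l). \<bar>g (y i)\<bar> \<le> e"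
  proof eventually_elim
    case (elim i)
    have "\<bar>(f n - l) (y i)\<bar> \<le> e" for n
      using elim N[of n "y i"] K(4) by (cases "n < N") (force intro: less_imp_le)+
    then show ?case by blast
  qed
qed

section \<open>Finite nets and the passage from Mackey to norm\<close>

lemma separated_sequence:
  assumes "\<And>F. finite F \<Longrightarrow> \<exists>x. P x \<and> (\<forall>z\<in>F. R x z)"
  shows "\<exists>x :: nat \<Rightarrow> 'b. (\<forall>n. P (x n)) \<and> (\<forall>m n. m < n \<longrightarrow> R (x n) (x m))"
proof -
  obtain g where g: "\<And>F. finite F \<Longrightarrow> P (g F)" "\<And>F z. finite F \<Longrightarrow> z \<in> F \<Longrightarrow> R (g F) z"
    using assms by metis
  define X where "X = rec_nat {} (\<lambda>_ F. insert (g F) F)"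
  have X_Suc: "X (Suc n) = insert (g (X n)) (X n)" for n by (simp add: X_def)
  have fin: "finite (X n)" for n by (induction n) (simp_all add: X_def)
  have mem: "g (X m) \<in> X n" if "m < n" for m n
    using that by (induction n) (auto simp: X_Suc less_Suc_eq)
  show ?thesis
    by (rule exI[of _ "\<lambda>n. g (X n)"]) (use g fin mem in auto)
qed

text \<open>Without a finite net the ball contains a sequence any two of whose terms are told apart
  by more than \<open>e\<close> by some functional in \<open>A\<close>. Consecutive differences
  along Rosenthal's subsequence are bounded by 2 and weakly null, against
  \<open>L_set A\<close>.\<close>

lemma L_set_imp_unit_ball_precompact:
  fixes A :: "('a::banach \<Rightarrow>\<^sub>L real) set"
  assumes no_l1: "\<not> contains_l1 TYPE('a)" and A: "L_set A" and e: "0 < e"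
  obtains F where "finite F" "\<And>x. norm x \<le> 1 \<Longrightarrow> \<exists>z\<in>F. \<forall>f\<in>A. \<bar>f (x - z)\<bar> \<le> e"
proof (rule ccontr)
  note net = that
  assume no_net: "\<not> thesis"
  have far: "\<exists>x. norm x \<le> 1 \<and> (\<forall>z\<in>F. \<exists>f\<in>A. \<not> \<bar>f (x - z)\<bar> \<le> e)" if F: "finite F" for F
  proof (rule ccontr)
    assume "\<nexists>x. norm x \<le> 1 \<and> (\<forall>z\<in>F. \<exists>f\<in>A. \<not> \<bar>f (x - z)\<bar> \<le> e)"
    then have thesis by (intro net[OF F]) simp
    with no_net show False by contradiction
  qed
  obtain x :: "nat \<Rightarrow> 'a" where x': "(\<forall>n. norm (x n) \<le> 1) \<and> (\<forall>m n. m < n \<longrightarrow> (\<exists>f\<in>A. \<not> \<bar>f (x n - x m)\<bar> \<le> e))"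
    using separated_sequence[of "\<lambda>x. norm x \<le> 1" "\<lambda>x z. \<exists>f\<in>A. \<not> \<bar>f (x - z)\<bar> \<le> e", OF far] by (rule exE)
  note x = x'[THEN conjunct1, rule_format] x'[THEN conjunct2, rule_format]
  obtain k :: "nat \<Rightarrow> nat" where k: "strict_mono k" "\<And>f :: 'a \<Rightarrow>\<^sub>L real. convergent (\<lambda>n. f (x (k n)))"
    by (rule Rosenthal_l1[of x 1, OF no_l1 x(1)]) blast
  define y where "y n = x (k (Suc n)) - x (k n)" for n
  have "weakly_null y"
    unfolding weakly_null_def
  proof
    fix f :: "'a \<Rightarrow>\<^sub>L real"
    obtain l where l: "(\<lambda>n. f (x (k n))) \<longlonglongrightarrow> l" using k(2) by (auto simp: convergent_def)
    then have "(\<lambda>n. f (x (k (Suc n))) - f (x (k n))) \<longlonglongrightarrow> l - l"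
      by (intro tendsto_diff LIMSEQ_Suc)
    then show "(\<lambda>n. f (y n)) \<longlonglongrightarrow> 0" by (simp add: y_def blinfun.diff_right)
  qed
  moreover have "norm (y n) \<le> 2" for n
    using norm_triangle_ineq4[of "x (k (Suc n))" "x (k n)"] x(1)[of "k (Suc n)"] x(1)[of "k n"]
    unfolding y_def by linarith
  ultimately have "\<forall>\<^sub>F n in sequentially. \<forall>f\<in>A. \<bar>f (y n)\<bar> \<le> e"
    using A e unfolding L_set_def by blast
  then obtain n where "\<forall>f\<in>A. \<bar>f (y n)\<bar> \<le> e" by (auto simp: eventually_sequentially)
  then show False
    using x(2)[of "k n" "k (Suc n)"] k(1) by (auto simp: y_def strict_mono_Suc_iff)
qed

lemma norm_blinfun_le_of_unit_ball:
  fixes f :: "'a::real_normed_vector \<Rightarrow>\<^sub>L real"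
  assumes "\<And>x. norm x \<le> 1 \<Longrightarrow> \<bar>f x\<bar> \<le> c"
  shows "norm f \<le> c"
proof (rule norm_blinfun_bound)
  show "0 \<le> c" using assms[of 0] by simp
  fix x
  show "norm (f x) \<le> c * norm x"
    using assms[of "inverse (norm x) *\<^sub>R x"]
    by (cases "x = 0") (simp_all add: blinfun.scaleR_right abs_mult field_simps)
qed

text \<open>Convergence at the finitely many points of a net, where pointwise information is enough,
  becomes uniform on the ball: net error and value at the net point are each at most
  \<open>e / 4\<close>.\<close>

lemma mackey_limit_imp_norm_limit:
  fixes f :: "nat \<Rightarrow> 'a::banach \<Rightarrow>\<^sub>L real"
  assumes no_l1: "\<not> contains_l1 TYPE('a)" and lim: "limitin mackey_topology f l sequentially"
  shows "f \<longlonglongrightarrow> l"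
proof (rule tendstoI)
  fix e :: real assume e: "0 < e"
  obtain F where F: "finite F"
    "\<And>x. norm x \<le> 1 \<Longrightarrow> \<exists>z\<in>F. \<forall>g\<in>range (\<lambda>n. f n - l). \<bar>g (x - z)\<bar> \<le> e / 4"
    by (rule L_set_imp_unit_ball_precompact[OF no_l1 L_set_limitin[OF lim], of "e / 4"]) (use e in auto)
  have "\<forall>\<^sub>F n in sequentially. \<bar>(f n - l) z\<bar> \<le> e / 4" for z
  proof -
    obtain K where "compactin weak_topology K" "convex K" "circled K" "z \<in> K"
      by (rule point_in_weakly_compact_disc)
    with eventually_uniform_of_limitin_mackey[OF lim, of "e / 4" K] e show ?thesis
      by (auto elim: eventually_mono)
  qed
  then have "\<forall>\<^sub>F n in sequentially. \<forall>z\<in>F. \<bar>(f n - l) z\<bar> \<le> e / 4"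
    using F(1) by (simp add: eventually_ball_finite)
  then show "\<forall>\<^sub>F n in sequentially. dist (f n) l < e"
  proof eventually_elim
    case (elim n)
    have "norm (f n - l) \<le> e / 2"
    proof (rule norm_blinfun_le_of_unit_ball)
      fix x :: 'a assume "norm x \<le> 1"
      with F(2) obtain z where z: "z \<in> F" "\<bar>(f n - l) (x - z)\<bar> \<le> e / 4" by blast
      with elim have "\<bar>(f n - l) z\<bar> \<le> e / 4" by blast
      with z(2) show "\<bar>(f n - l) x\<bar> \<le> e / 2" unfolding blinfun.diff_right by linarith
    qed
    then show ?case using e by (simp add: dist_norm)
  qed
qed

lemma precompact_in_mackey_imp_pointwise_bounded:
  fixes A :: "('a::banach \<Rightarrow>\<^sub>L real) set"
  assumes A: "precompact_in mackey_topology A"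
  shows "\<exists>M. \<forall>f\<in>A. \<bar>f x\<bar> \<le> M"
proof -
  obtain K where K: "compactin weak_topology K" "convex K" "circled K" "x \<in> K"
    by (rule point_in_weakly_compact_disc)
  define U where "U = {f :: 'a \<Rightarrow>\<^sub>L real. \<exists>d<1. \<forall>x\<in>K. \<bar>f x - blinfun_apply 0 x\<bar> \<le> d}"
  have "openin mackey_topology U"
    unfolding U_def by (rule openin_mackey_nhd[OF K(1-3)])
  moreover have "0 \<in> U" by (auto simp: U_def intro!: exI[of _ 0])
  ultimately obtain F where F: "finite F" "A \<subseteq> (\<Union>a\<in>F. (\<lambda>u. a + u) ` U)"
    by (rule precompact_inE[OF A])
  have "\<bar>f x\<bar> \<le> (\<Sum>g\<in>F. \<bar>blinfun_apply g x\<bar>) + 1" if "f \<in> A" for f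
  proof -
    from that F(2) obtain g u where g: "g \<in> F" "u \<in> U" "f = g + u" by blast
    have "\<bar>u x\<bar> \<le> 1" using g(2) K(4) by (force simp: U_def)
    moreover have "\<bar>g x\<bar> \<le> (\<Sum>g\<in>F. \<bar>blinfun_apply g x\<bar>)" using g(1) F(1) by (intro member_le_sum) auto
    moreover have "\<bar>f x\<bar> \<le> \<bar>g x\<bar> + \<bar>u x\<bar>"
      unfolding g(3) blinfun.add_left by (rule abs_triangle_ineq)
    ultimately show ?thesis by linarith
  qed
  then show ?thesis by blast
qed

text \<open>Pigeonhole: rounding the values on \<open>F\<close> down to multiples of
  \<open>e\<close> leaves finitely many patterns, and functions with equal patterns differ by less
  than \<open>e\<close>. The representatives are taken from \<open>A\<close> itself, so estimates
  valid on \<open>A\<close> apply to them.\<close>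

lemma pointwise_bounded_finite_net:
  fixes A :: "('a \<Rightarrow> real) set"
  assumes F: "finite F" and bdd: "\<And>x. \<exists>M. \<forall>f\<in>A. \<bar>f x\<bar> \<le> M" and e: "0 < e"
  obtains G where "finite G" "G \<subseteq> A" "\<And>f. f \<in> A \<Longrightarrow> \<exists>g\<in>G. \<forall>x\<in>F. \<bar>f x - g x\<bar> \<le> e"
proof -
  obtain M where M: "\<And>f x. f \<in> A \<Longrightarrow> \<bar>f x\<bar> \<le> M x" using bdd by metis
  define h where "h f = restrict (\<lambda>x. \<lfloor>f x / e\<rfloor>) F" for f
  have "h ` A \<subseteq> PiE F (\<lambda>x. {\<lfloor>- M x / e\<rfloor>..\<lfloor>M x / e\<rfloor>})"
  proof -
    have "- M x / e \<le> f x / e \<and> f x / e \<le> M x / e" if "f \<in> A" for f x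
      using M[OF that, of x] e divide_right_mono[of "- M x" "f x" e] divide_right_mono[of "f x" "M x" e]
      by (simp add: abs_le_iff)
    then show ?thesis by (auto simp: h_def intro!: floor_mono)
  qed
  then have "finite (h ` A)"
    by (rule finite_subset) (use F in \<open>simp add: finite_PiE\<close>)
  then obtain G where G: "G \<subseteq> A" "finite G" "h ` A = h ` G"
    using finite_subset_image[of "h ` A" h A] by blast
  have "\<exists>g\<in>G. \<forall>x\<in>F. \<bar>f x - g x\<bar> \<le> e" if "f \<in> A" for f
  proof -
    from that G(3) obtain g where g: "g \<in> G" "h f = h g" by blast
    have "\<bar>f x - g x\<bar> \<le> e" if "x \<in> F" for x
    proof -
      have "\<lfloor>f x / e\<rfloor> = \<lfloor>g x / e\<rfloor>" using fun_cong[OF g(2), of x] that by (simp add: h_def)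
      then have "\<bar>f x / e - g x / e\<bar> < 1" by linarith
      then show ?thesis using e by (simp add: field_simps abs_less_iff abs_le_iff)
    qed
    with g(1) show ?thesis by blast
  qed
  then show thesis using that G by blast
qed

text \<open>Grothendieck's duality argument: precompactness of the unit ball of \<open>X\<close> for uniform convergence
  on \<open>A\<close> gives precompactness of \<open>A\<close> for uniform convergence on the unit ball.\<close>

lemma mackey_precompact_imp_norm_precompact:
  fixes A :: "('a::banach \<Rightarrow>\<^sub>L real) set"
  assumes no_l1: "\<not> contains_l1 TYPE('a)" and A: "precompact_in mackey_topology A"
  shows "precompact_in dual_norm_topology A"
  unfolding precompact_in_def dual_norm_topology_def open_openin[symmetric]
proof (intro allI impI)
  fix U :: "('a \<Rightarrow>\<^sub>L real) set" assume "open U" "0 \<in> U"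
  then obtain r where r: "0 < r" "ball 0 r \<subseteq> U" by (meson openE)
  \<comment> \<open>Three errors of size \<open>e\<close> will add up, from \<open>f\<close> at
    \<open>x - z\<close>, \<open>f - g\<close> at \<open>z\<close> and \<open>g\<close> at
    \<open>x - z\<close>; their sum \<open>3 * e\<close> is still below \<open>r\<close>.\<close>
  define e where "e = r / 4"
  have e: "0 < e" using r by (simp add: e_def)
  obtain F where F: "finite F"
    "\<And>x. norm x \<le> 1 \<Longrightarrow> \<exists>z\<in>F. \<forall>f\<in>A. \<bar>f (x - z)\<bar> \<le> e"
    using L_set_imp_unit_ball_precompact[OF no_l1 L_set_precompact[OF A] e] by blast
  have "\<exists>M. \<forall>f\<in>blinfun_apply ` A. \<bar>f x\<bar> \<le> M" for x
    using precompact_in_mackey_imp_pointwise_bounded[OF A] by auto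
  then obtain G' where G': "finite G'" "G' \<subseteq> blinfun_apply ` A"
    "\<And>f. f \<in> blinfun_apply ` A \<Longrightarrow> \<exists>g\<in>G'. \<forall>x\<in>F. \<bar>f x - g x\<bar> \<le> e"
    using pointwise_bounded_finite_net[OF F(1) _ e] by metis
  obtain G where G: "finite G" "G \<subseteq> A" "G' = blinfun_apply ` G"
    using finite_subset_image[OF G'(1,2)] by blast
  have "A \<subseteq> (\<Union>g\<in>G. (\<lambda>u. g + u) ` U)"
  proof
    fix f assume f: "f \<in> A"
    with G'(3) G(3) obtain g where g: "g \<in> G" "\<And>x. x \<in> F \<Longrightarrow> \<bar>f x - g x\<bar> \<le> e" by blast
    have "norm (f - g) \<le> 3 * e"
    proof (rule norm_blinfun_le_of_unit_ball)
      fix x :: 'a assume "norm x \<le> 1"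
      with F(2) obtain z where z: "z \<in> F" "\<And>f. f \<in> A \<Longrightarrow> \<bar>f (x - z)\<bar> \<le> e" by blast
      show "\<bar>(f - g) x\<bar> \<le> 3 * e"
        using z(2)[OF f] z(2)[of g] g(1) G(2) g(2)[OF z(1)]
        by (auto simp: blinfun.diff_right blinfun.diff_left)
    qed
    then have "f - g \<in> U" using r e by (auto simp: e_def intro!: subsetD[OF r(2)])
    then have "f \<in> (\<lambda>u. g + u) ` U" by (intro image_eqI[of _ _ "f - g"]) auto
    with g(1) show "f \<in> (\<Union>g\<in>G. (\<lambda>u. g + u) ` U)" by blast
  qed
  with G(1) show "\<exists>F. finite F \<and> A \<subseteq> (\<Union>a\<in>F. (\<lambda>u. a + u) ` U)" by blast
qed

text \<open>Every point lies in a weakly compact disc, so Mackey bounded sets are pointwise bounded,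
  and uniform boundedness on \<open>X\<close> applies.\<close>

lemma bounded_in_mackey_imp_bounded:
  fixes A :: "('a::banach \<Rightarrow>\<^sub>L real) set"
  assumes A: "bounded_in mackey_topology A"
  shows "bounded A"
proof -
  have "\<exists>M. \<forall>f\<in>A. norm (f x) \<le> M" for x
  proof -
    obtain K where K: "compactin weak_topology K" "convex K" "circled K" "x \<in> K"
      by (rule point_in_weakly_compact_disc)
    define U where "U = {f :: 'a \<Rightarrow>\<^sub>L real. \<exists>d<1. \<forall>x\<in>K. \<bar>f x - blinfun_apply 0 x\<bar> \<le> d}"
    have "openin mackey_topology U"
      unfolding U_def by (rule openin_mackey_nhd[OF K(1-3)])
    moreover have "0 \<in> U" by (auto simp: U_def intro!: exI[of _ 0])
    ultimately have "absorbs U A" using A unfolding bounded_in_def by blast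
    then obtain r where r: "0 < r" "\<forall>c. r \<le> \<bar>c\<bar> \<longrightarrow> A \<subseteq> (\<lambda>f. c *\<^sub>R f) ` U"
      unfolding absorbs_def by blast
    have "norm (f x) \<le> r" if "f \<in> A" for f
    proof -
      have "A \<subseteq> (\<lambda>f. r *\<^sub>R f) ` U" using r by simp
      with that obtain u where u: "u \<in> U" "f = r *\<^sub>R u" by blast
      have "\<bar>u x\<bar> \<le> 1" using u(1) K(4) by (force simp: U_def)
      then show ?thesis using r(1) by (simp add: u(2) blinfun.scaleR_left abs_mult)
    qed
    then show ?thesis by blast
  qed
  then obtain M where "\<And>f. f \<in> A \<Longrightarrow> norm f \<le> M"
    using uniform_boundedness by blast
  then show ?thesis by (auto simp: bounded_iff)
qed

section \<open>Locally convex topologies on a normed space\<close>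

lemma topspace_linear_topology: "linear_topology S \<Longrightarrow> topspace S = UNIV"
  by (simp add: linear_topology_def)

lemma openin_linear_topology_affine_preimage:
  assumes S: "linear_topology S" and U: "openin S U"
  shows "openin S {y. c *\<^sub>R y + b \<in> U}"
proof -
  have "continuous_map S (prod_topology euclideanreal S) (\<lambda>y. (c, y))"
    by (auto simp: continuous_map_pairwise o_def)
  from continuous_map_compose[OF this, of S "\<lambda>(c, x). c *\<^sub>R x"] S
  have scale: "continuous_map S S (\<lambda>y. c *\<^sub>R y)"
    by (simp add: linear_topology_def o_def)
  have "continuous_map S (prod_topology S S) (\<lambda>y. (c *\<^sub>R y, b))"
    using scale topspace_linear_topology[OF S] by (simp add: continuous_map_pairwise o_def)
  from continuous_map_compose[OF this, of S "\<lambda>(x, y). x + y"] S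
  have "continuous_map S S (\<lambda>y. c *\<^sub>R y + b)"
    by (simp add: linear_topology_def o_def)
  then have "openin S {y \<in> topspace S. c *\<^sub>R y + b \<in> U}"
    using U by (rule openin_continuous_map_preimage)
  then show ?thesis by (simp add: topspace_linear_topology[OF S])
qed

lemma linear_topology_absorbing:
  assumes S: "linear_topology S" and W: "openin S W" "0 \<in> W"
  obtains d where "0 < d" "\<And>c. \<bar>c\<bar> < d \<Longrightarrow> c *\<^sub>R x \<in> W"
proof -
  have "continuous_map euclideanreal (prod_topology euclideanreal S) (\<lambda>c. (c, x))"
    using topspace_linear_topology[OF S] by (simp add: continuous_map_pairwise o_def)
  from continuous_map_compose[OF this, of S "\<lambda>(c, x). c *\<^sub>R x"] S
  have "continuous_map euclideanreal S (\<lambda>c. c *\<^sub>R x)"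
    by (simp add: linear_topology_def o_def)
  then have "openin euclideanreal {c \<in> topspace euclideanreal. c *\<^sub>R x \<in> W}"
    using W(1) by (rule openin_continuous_map_preimage)
  then have "open {c. c *\<^sub>R x \<in> W}" by simp
  then obtain d where "0 < d" "ball 0 d \<subseteq> {c. c *\<^sub>R x \<in> W}"
    using W(2) by (metis (mono_tags) mem_Collect_eq openE scaleR_zero_left)
  then show thesis using that[of d] by (auto simp: subset_iff)
qed

text \<open>Translation reduces the comparison to neighbourhoods of 0. This is the common frame of
  the maximality proofs: \<open>V\<close> is the convex neighbourhood to be tested, \<open>W\<close>
  an open set witnessing that it is one.\<close>

lemma coarser_euclideanI:
  fixes S :: "'e::real_normed_vector topology"
  assumes S: "locally_convex_topology S"
    and nhd: "\<And>V W. convex V \<Longrightarrow> openin S W \<Longrightarrow> 0 \<in> W \<Longrightarrow> W \<subseteq> V \<Longrightarrow> \<exists>e>0. ball 0 e \<subseteq> V"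
  shows "S \<preceq> euclidean"
  unfolding coarser_def open_openin[symmetric]
proof (intro allI impI)
  fix U assume U: "openin S U"
  have lin: "linear_topology S" and base: "neighbourhood_base_at 0 convex S"
    using S by (auto simp: locally_convex_topology_def)
  show "open U"
    unfolding open_contains_ball
  proof
    fix x assume "x \<in> U"
    define U' where "U' = {y. 1 *\<^sub>R y + x \<in> U}"
    have "openin S U'" "0 \<in> U'"
      using openin_linear_topology_affine_preimage[OF lin U, of 1 x] \<open>x \<in> U\<close> by (auto simp: U'_def)
    with base obtain W V where "openin S W" "convex V" "0 \<in> W" "W \<subseteq> V" "V \<subseteq> U'"
      unfolding neighbourhood_base_at_def by metis
    with nhd obtain e where e: "0 < e" "ball 0 e \<subseteq> U'" by (meson order_trans)
    have "ball x e \<subseteq> U"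
    proof
      fix y assume "y \<in> ball x e"
      then have "y - x \<in> U'" by (intro subsetD[OF e(2)]) (simp add: dist_norm norm_minus_commute)
      then show "y \<in> U" by (simp add: U'_def)
    qed
    with e(1) show "\<exists>e>0. ball x e \<subseteq> U" by blast
  qed
qed

lemma locally_convex_euclidean:
  "locally_convex_topology (euclidean :: 'e::real_normed_vector topology)"
  unfolding locally_convex_topology_def linear_topology_def
proof (intro conjI)
  show "continuous_map (prod_topology euclidean euclidean) euclidean (\<lambda>(x, y). x + y :: 'e)"
    by (simp add: case_prod_unfold) (intro continuous_intros)
  show "continuous_map (prod_topology euclideanreal euclidean) euclidean (\<lambda>(c, x). c *\<^sub>R x :: 'e)"
    by (simp add: case_prod_unfold) (intro continuous_intros)
  show "neighbourhood_base_at 0 convex (euclidean :: 'e topology)"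
    unfolding neighbourhood_base_at_def open_openin[symmetric]
  proof (intro allI impI)
    fix W :: "'e set" assume "open W \<and> 0 \<in> W"
    then obtain e where "0 < e" "ball 0 e \<subseteq> W" by (meson openE)
    then show "\<exists>U V. open U \<and> convex V \<and> 0 \<in> U \<and> U \<subseteq> V \<and> V \<subseteq> W"
      by (intro exI[of _ "ball 0 e"]) auto
  qed
qed simp

lemma coarser_limitin:
  assumes "S \<preceq> T" "topspace S = UNIV" "limitin T f l F"
  shows "limitin S f l F"
  using assms by (auto simp: limitin_def coarser_def)

lemma coarser_precompact_in: "S \<preceq> T \<Longrightarrow> precompact_in T A \<Longrightarrow> precompact_in S A"
  by (auto simp: precompact_in_def coarser_def)

lemma coarser_bounded_in: "S \<preceq> T \<Longrightarrow> bounded_in T A \<Longrightarrow> bounded_in S A"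
  by (auto simp: bounded_in_def coarser_def)

section \<open>Maximality for convergent sequences and for precompact sets\<close>

lemma small_sequence_outside:
  fixes V :: "'e::real_normed_vector set"
  assumes "\<not> (\<exists>e>0. ball 0 e \<subseteq> V)" and "\<And>n. 0 < r n"
  obtains f where "\<And>n. f n \<notin> V" "\<And>n. norm (f n) < r n"
proof -
  have "\<exists>x. x \<notin> V \<and> norm x < r n" for n
    using assms by (force simp: subset_iff)
  then show thesis using that by metis
qed

lemma is_finest_lc_same_convergent_sequences:
  assumes seq: "same_convergent_sequences (euclidean :: 'e::real_normed_vector topology) T"
  shows "is_finest_lc (\<lambda>S. same_convergent_sequences S T) euclidean"
  unfolding is_finest_lc_def
proof (intro conjI allI impI)
  fix S assume S: "locally_convex_topology S" and "same_convergent_sequences S T"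
  with seq have eq: "limitin S x l sequentially \<longleftrightarrow> x \<longlonglongrightarrow> l" for x l
    unfolding same_convergent_sequences_def by simp
  show "S \<preceq> euclidean"
  proof (rule coarser_euclideanI[OF S])
    fix V W assume W: "openin S W" "0 \<in> W" "W \<subseteq> V"
    show "\<exists>e>0. ball 0 e \<subseteq> V"
    proof (rule ccontr)
      assume "\<not> (\<exists>e>0. ball 0 e \<subseteq> V)"
      then obtain f where f: "\<And>n. f n \<notin> V" "\<And>n. norm (f n) < inverse (real (Suc n))"
        by (rule small_sequence_outside[where r = "\<lambda>n. inverse (real (Suc n))"]) auto
      have "f \<longlonglongrightarrow> 0"
        using f(2) by (intro Lim_null_comparison[OF _ LIMSEQ_inverse_real_of_nat] always_eventually)
          (auto intro: less_imp_le)
      then have "limitin S f 0 sequentially" by (simp add: eq)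
      with W have "\<forall>\<^sub>F n in sequentially. f n \<in> W" by (auto simp: limitin_def)
      then show False using f(1) W(3) by (auto simp: eventually_sequentially)
    qed
  qed
qed (use seq locally_convex_euclidean in auto)

lemma precompact_range_null_sequence:
  fixes h :: "nat \<Rightarrow> 'e::real_normed_vector"
  assumes "h \<longlonglongrightarrow> 0"
  shows "precompact_in euclidean (range h)"
  unfolding precompact_in_def open_openin[symmetric]
proof (intro allI impI)
  fix U :: "'e set" assume U: "open U" "0 \<in> U"
  then obtain N where N: "\<And>n. N \<le> n \<Longrightarrow> h n \<in> U"
    using assms by (auto simp: tendsto_def eventually_sequentially)
  have "h n \<in> (\<Union>a\<in>insert 0 (h ` {..<N}). (\<lambda>u. a + u) ` U)" for n
  proof (cases "n < N")
    case True
    then show ?thesis using U(2) by (force intro!: image_eqI[of _ _ 0])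
  next
    case False
    then show ?thesis using N[of n] by auto
  qed
  then show "\<exists>F. finite F \<and> range h \<subseteq> (\<Union>a\<in>F. (\<lambda>u. a + u) ` U)"
    by (intro exI[of _ "insert 0 (h ` {..<N})"]) blast
qed

text \<open>Points \<open>f n\<close> outside \<open>V\<close> are chosen so small that
  \<open>h n = (n + 1) *\<^sub>R f n\<close> is still null; its range is then precompact for
  \<open>S\<close> and covered by finitely many translates \<open>a + W\<close>. Scaled by
  \<open>2 / (n + 1)\<close>, both parts of \<open>h n = a + w\<close> fall into the convex set
  \<open>V\<close> for large \<open>n\<close>, and their midpoint is \<open>f n\<close>.\<close>

lemma is_finest_lc_same_precompact_sets:
  assumes pre: "same_precompact_sets (euclidean :: 'e::real_normed_vector topology) T"
  shows "is_finest_lc (\<lambda>S. same_precompact_sets S T) euclidean"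
  unfolding is_finest_lc_def
proof (intro conjI allI impI)
  fix S assume S: "locally_convex_topology S" and "same_precompact_sets S T"
  with pre have eq: "precompact_in S A \<longleftrightarrow> precompact_in euclidean A" for A
    unfolding same_precompact_sets_def by simp
  have lin: "linear_topology S" using S by (simp add: locally_convex_topology_def)
  show "S \<preceq> euclidean"
  proof (rule coarser_euclideanI[OF S])
    fix V W assume V: "convex V" and W: "openin S W" "0 \<in> W" "W \<subseteq> V"
    show "\<exists>e>0. ball 0 e \<subseteq> V"
    proof (rule ccontr)
      assume "\<not> (\<exists>e>0. ball 0 e \<subseteq> V)"
      then obtain f where f: "\<And>n. f n \<notin> V" "\<And>n. norm (f n) < (inverse (real (Suc n)))\<^sup>2"
        by (rule small_sequence_outside[where r = "\<lambda>n. (inverse (real (Suc n)))\<^sup>2"]) auto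
      define h where "h n = real (Suc n) *\<^sub>R f n" for n
      have "norm (h n) \<le> inverse (real (Suc n))" for n
      proof -
        have "real (Suc n) * norm (f n) \<le> real (Suc n) * (inverse (real (Suc n)))\<^sup>2"
          using f(2)[of n] by (intro mult_left_mono less_imp_le) auto
        also have "\<dots> = inverse (real (Suc n))" by (simp add: power2_eq_square del: of_nat_Suc)
        finally show ?thesis by (simp add: h_def)
      qed
      then have "h \<longlonglongrightarrow> 0"
        by (intro Lim_null_comparison[OF _ LIMSEQ_inverse_real_of_nat] always_eventually) auto
      then have "precompact_in S (range h)"
        using precompact_range_null_sequence by (simp add: eq)
      with W obtain F where F: "finite F" "range h \<subseteq> (\<Union>a\<in>F. (\<lambda>u. a + u) ` W)"
        unfolding precompact_in_def by metis
      have "\<exists>d>0. \<forall>c. \<bar>c\<bar> < d \<longrightarrow> c *\<^sub>R a \<in> W" for a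
        using linear_topology_absorbing[OF lin W(1,2)] by metis
      then obtain d where d: "\<And>a. 0 < d a" "\<And>a c. \<bar>c\<bar> < d a \<Longrightarrow> c *\<^sub>R a \<in> W" by metis
      have "(\<lambda>n. 2 / real (Suc n)) \<longlonglongrightarrow> 0"
        using tendsto_mult_right_zero[OF LIMSEQ_inverse_real_of_nat, of 2] by (simp add: divide_inverse)
      then have "\<forall>\<^sub>F n in sequentially. \<forall>a\<in>F. 2 / real (Suc n) < d a"
        using d(1) F(1) by (intro eventually_ball_finite ballI order_tendstoD) auto
      then obtain N where N: "\<And>n a. N \<le> n \<Longrightarrow> a \<in> F \<Longrightarrow> 2 / real (Suc n) < d a"
        by (auto simp: eventually_sequentially)
      \<comment> \<open>The successor guarantees \<open>2 / (n + 1) \<le> 1\<close>, as needed to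
        shrink \<open>w\<close> towards 0 inside the convex set \<open>V\<close>.\<close>
      define n where "n = Suc N"
      from F(2) obtain a w where aw: "a \<in> F" "w \<in> W" "h n = a + w" by blast
      define c where "c = 2 / real (Suc n)"
      have c: "0 < c" "c \<le> 1" by (auto simp: c_def n_def)
      have "c *\<^sub>R a \<in> V" using d(2)[of c a] N[OF _ aw(1), of n] c W(3) by (auto simp: c_def n_def)
      moreover have "c *\<^sub>R w \<in> V"
        using convexD_alt[OF V, of 0 w c] c W aw(2) by auto
      ultimately have "(1/2) *\<^sub>R (c *\<^sub>R a) + (1/2) *\<^sub>R (c *\<^sub>R w) \<in> V"
        using V by (intro convexD) auto
      moreover have "(1/2) *\<^sub>R (c *\<^sub>R a) + (1/2) *\<^sub>R (c *\<^sub>R w) = (c/2) *\<^sub>R h n"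
        by (simp add: aw(3) scaleR_add_right)
      moreover have "c / 2 * real (Suc n) = 1" by (simp add: c_def del: of_nat_Suc)
      then have "(c/2) *\<^sub>R h n = f n" by (simp only: h_def scaleR_scaleR scaleR_one)
      ultimately show False using f(1) by simp
    qed
  qed
qed (use pre locally_convex_euclidean in auto)

lemma linear_bounded_on_nhd_continuous:
  assumes S: "linear_topology S" and \<phi>: "linear \<phi>" and W: "openin S W" "0 \<in> W"
    and le: "\<And>x. x \<in> W \<Longrightarrow> \<bar>\<phi> x\<bar> \<le> (1::real)"
  shows "continuous_map S euclideanreal \<phi>"
  unfolding continuous_map_def
proof (intro conjI allI impI)
  fix G :: "real set" assume "openin euclideanreal G"
  then have G: "open G" by simp
  show "openin S {x \<in> topspace S. \<phi> x \<in> G}"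
  proof (subst openin_subopen, intro ballI)
    fix x assume "x \<in> {x \<in> topspace S. \<phi> x \<in> G}"
    then obtain e where e: "0 < e" "ball (\<phi> x) e \<subseteq> G" using G by (auto elim: openE)
    \<comment> \<open>This is \<open>x + (e / 2) W\<close>, written as an affine preimage to obtain
      openness; on it \<phi> differs from \<open>\<phi> x\<close> by at most
      \<open>e / 2\<close>.\<close>
    define N where "N = {y. (2 / e) *\<^sub>R y + (- (2 / e)) *\<^sub>R x \<in> W}"
    have "openin S N" unfolding N_def by (rule openin_linear_topology_affine_preimage[OF S W(1)])
    moreover have "x \<in> N" using W(2) by (simp add: N_def)
    moreover have "N \<subseteq> {x \<in> topspace S. \<phi> x \<in> G}"
    proof
      fix y assume "y \<in> N"
      then have "\<bar>\<phi> ((2 / e) *\<^sub>R y + (- (2 / e)) *\<^sub>R x)\<bar> \<le> 1" by (auto simp: N_def intro: le)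
      also have "\<phi> ((2 / e) *\<^sub>R y + (- (2 / e)) *\<^sub>R x) = 2 / e * (\<phi> y - \<phi> x)"
        using \<phi> by (simp add: linear_add linear_diff linear_scale algebra_simps diff_divide_distrib)
      finally have "\<bar>\<phi> y - \<phi> x\<bar> < e"
        using e(1) by (simp add: abs_mult field_simps)
      then show "y \<in> {x \<in> topspace S. \<phi> x \<in> G}"
        using e(2) topspace_linear_topology[OF S] by (auto simp: dist_real_def abs_minus_commute)
    qed
    ultimately show "\<exists>T. openin S T \<and> x \<in> T \<and> T \<subseteq> {x \<in> topspace S. \<phi> x \<in> G}" by blast
  qed
qed auto

section \<open>The Minkowski gauge and topologies with a prescribed dual\<close>

definition gauge_set :: "'e::real_vector set \<Rightarrow> 'e \<Rightarrow> real set" where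
  "gauge_set V x = {t. 0 < t \<and> inverse t *\<^sub>R x \<in> V}"

definition minkowski :: "'e::real_vector set \<Rightarrow> 'e \<Rightarrow> real" where
  "minkowski V x = Inf (gauge_set V x)"

lemma bdd_below_gauge_set: "bdd_below (gauge_set V x)"
  by (rule bdd_belowI[of _ 0]) (auto simp: gauge_set_def)

lemma minkowski_le: "0 < t \<Longrightarrow> inverse t *\<^sub>R x \<in> V \<Longrightarrow> minkowski V x \<le> t"
  unfolding minkowski_def by (rule cInf_lower[OF _ bdd_below_gauge_set]) (auto simp: gauge_set_def)

lemma sublinear_minkowski:
  assumes V: "convex V" and abs: "\<And>x. gauge_set V x \<noteq> {}"
  shows "sublinear (minkowski V)"
  unfolding sublinear_def
proof (intro conjI allI impI)
  have ge: "c \<le> minkowski V x" if "\<And>t. 0 < t \<Longrightarrow> inverse t *\<^sub>R x \<in> V \<Longrightarrow> c \<le> t" for c x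
    unfolding minkowski_def using abs that by (intro cInf_greatest) (auto simp: gauge_set_def)
  fix x y
  have add: "minkowski V (x + y) \<le> s + t"
    if "0 < s" "inverse s *\<^sub>R x \<in> V" "0 < t" "inverse t *\<^sub>R y \<in> V" for s t
  proof (rule minkowski_le)
    show "0 < s + t" using that by simp
    \<comment> \<open>The weights are chosen so that the factors \<open>inverse s\<close> and
      \<open>inverse t\<close> both become \<open>inverse (s + t)\<close>.\<close>
    have "(s / (s + t)) *\<^sub>R (inverse s *\<^sub>R x) + (t / (s + t)) *\<^sub>R (inverse t *\<^sub>R y) \<in> V"
      using that V by (intro convexD) (auto simp: add_divide_distrib[symmetric])
    then show "inverse (s + t) *\<^sub>R (x + y) \<in> V"
      using that by (simp add: scaleR_add_right inverse_eq_divide)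
  qed
  have "minkowski V (x + y) - minkowski V x \<le> minkowski V y"
  proof (rule ge)
    fix t assume t: "0 < t" "inverse t *\<^sub>R y \<in> V"
    have "minkowski V (x + y) - t \<le> minkowski V x"
      using add t by (intro ge) (simp add: algebra_simps)
    then show "minkowski V (x + y) - minkowski V x \<le> t" by simp
  qed
  then show "minkowski V (x + y) \<le> minkowski V x + minkowski V y" by simp
next
  have ge: "c \<le> minkowski V x" if "\<And>t. 0 < t \<Longrightarrow> inverse t *\<^sub>R x \<in> V \<Longrightarrow> c \<le> t" for c x
    unfolding minkowski_def using abs that by (intro cInf_greatest) (auto simp: gauge_set_def)
  have le: "minkowski V (r *\<^sub>R x) \<le> r * minkowski V x" if r: "0 < r" for r x
  proof -
    have "minkowski V (r *\<^sub>R x) / r \<le> minkowski V x"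
    proof (rule ge)
      fix t assume "0 < t" "inverse t *\<^sub>R x \<in> V"
      then have "minkowski V (r *\<^sub>R x) \<le> r * t"
        using r by (intro minkowski_le) (auto simp: field_simps)
      then show "minkowski V (r *\<^sub>R x) / r \<le> t" using r by (simp add: field_simps)
    qed
    then show ?thesis using r by (simp add: field_simps)
  qed
  fix r :: real and x assume r: "0 < r"
  have "minkowski V (inverse r *\<^sub>R (r *\<^sub>R x)) \<le> inverse r * minkowski V (r *\<^sub>R x)"
    using r by (intro le) auto
  then have "r * minkowski V x \<le> minkowski V (r *\<^sub>R x)" using r by (simp add: field_simps)
  with le[OF r, of x] show "minkowski V (r *\<^sub>R x) = r * minkowski V x" by simp
qed

text \<open>The functionals that are at most 1 on a symmetric convex neighbourhood are pointwise bounded, hence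
  norm bounded by some \<open>M\<close>; by Hahn--Banach the neighbourhood then contains the ball of radius \<open>1 / M\<close>.\<close>

lemma coarser_norm_of_dual_bounded:
  fixes S :: "'e::banach topology"
  assumes S: "locally_convex_topology S" and dual: "\<And>\<phi>. \<phi> \<in> topological_dual S \<Longrightarrow> bounded_linear \<phi>"
  shows "S \<preceq> euclidean"
proof (rule coarser_euclideanI[OF S])
  fix V0 W0 assume V0: "convex V0" and W0: "openin S W0" "0 \<in> W0" "W0 \<subseteq> V0"
  have lin: "linear_topology S" using S by (simp add: locally_convex_topology_def)
  \<comment> \<open>Symmetrising turns the one-sided bound 1 for functionals on \<open>V\<close>
    into a bound for absolute values.\<close>
  define V where "V = V0 \<inter> uminus ` V0"
  define W where "W = W0 \<inter> {y. (-1) *\<^sub>R y + 0 \<in> W0}"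
  have V: "convex V"
    unfolding V_def by (intro convex_Int V0 convex_negations)
  have V_uminus: "- x \<in> V" if "x \<in> V" for x using that by (auto simp: V_def)
  have W: "openin S W" "0 \<in> W"
    unfolding W_def using W0 openin_linear_topology_affine_preimage[OF lin W0(1), of "-1" 0] by auto
  have WV: "W \<subseteq> V"
  proof
    fix x assume "x \<in> W"
    then have "x \<in> V0" "- x \<in> V0" using W0(3) by (auto simp: W_def)
    then show "x \<in> V" by (auto simp: V_def intro: image_eqI[of _ _ "- x"])
  qed
  have absorb: "\<exists>t>0. t *\<^sub>R x \<in> V" for x
  proof -
    obtain d where "0 < d" "\<And>c. \<bar>c\<bar> < d \<Longrightarrow> c *\<^sub>R x \<in> W"
      using linear_topology_absorbing[OF lin W] by blast
    then show ?thesis using WV by (intro exI[of _ "d / 2"]) auto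
  qed
  define \<Phi> where "\<Phi> = {f :: 'e \<Rightarrow>\<^sub>L real. \<forall>x\<in>V. f x \<le> 1}"
  have "\<exists>M. \<forall>f\<in>\<Phi>. norm (f x) \<le> M" for x
  proof -
    obtain t where t: "0 < t" "t *\<^sub>R x \<in> V" using absorb by blast
    have "norm (f x) \<le> 1 / t" if "f \<in> \<Phi>" for f
    proof -
      have "f (t *\<^sub>R x) \<le> 1" "f (- (t *\<^sub>R x)) \<le> 1"
        using that t(2) V_uminus by (auto simp: \<Phi>_def)
      then show ?thesis
        using t(1) by (simp add: blinfun.scaleR_right blinfun.minus_right abs_le_iff field_simps)
    qed
    then show ?thesis by blast
  qed
  then obtain M where M: "0 < M" "\<And>f. f \<in> \<Phi> \<Longrightarrow> norm f \<le> M"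
    using uniform_boundedness by blast
  have "gauge_set V x \<noteq> {}" for x
  proof -
    obtain t where "0 < t" "t *\<^sub>R x \<in> V" using absorb by blast
    then have "inverse t \<in> gauge_set V x" by (simp add: gauge_set_def)
    then show ?thesis by blast
  qed
  then have subl: "sublinear (minkowski V)" by (rule sublinear_minkowski[OF V])
  have "z \<in> V" if z: "norm z < 1 / M" for z
  proof (rule ccontr)
    assume "z \<notin> V"
    \<comment> \<open>The convex set \<open>V\<close> contains 0, so it would contain
      \<open>z\<close> if it contained \<open>inverse t *\<^sub>R z\<close> for some
      \<open>t < 1\<close>.\<close>
    have ge: "1 \<le> minkowski V z"
      unfolding minkowski_def
    proof (rule cInf_greatest)
      show "gauge_set V z \<noteq> {}" by fact
      fix t assume "t \<in> gauge_set V z"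
      then have t: "0 < t" "inverse t *\<^sub>R z \<in> V" by (auto simp: gauge_set_def)
      show "1 \<le> t"
      proof (rule ccontr)
        assume "\<not> 1 \<le> t"
        then have "(1 - t) *\<^sub>R 0 + t *\<^sub>R (inverse t *\<^sub>R z) \<in> V"
          using t W(2) WV V by (intro convexD_alt) auto
        with t(1) \<open>z \<notin> V\<close> show False by simp
      qed
    qed
    obtain \<phi> where \<phi>: "linear \<phi>" "\<And>x. \<phi> x \<le> minkowski V x" "\<phi> z = minkowski V z"
      using Hahn_Banach_point[OF subl] by metis
    have le1: "\<phi> x \<le> 1" if "x \<in> V" for x
      using \<phi>(2)[of x] minkowski_le[of 1 x V] that by simp
    have "\<bar>\<phi> x\<bar> \<le> 1" if "x \<in> W" for x
      using le1[of x] le1[of "- x"] V_uminus[of x] that WV linear_neg[OF \<phi>(1), of x] by auto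
    then have "continuous_map S euclideanreal \<phi>"
      by (rule linear_bounded_on_nhd_continuous[OF lin \<phi>(1) W])
    then have "bounded_linear \<phi>"
      using \<phi>(1) by (intro dual) (simp add: topological_dual_def)
    then have ap: "blinfun_apply (Blinfun \<phi>) = \<phi>" by (rule bounded_linear_Blinfun_apply)
    then have "Blinfun \<phi> \<in> \<Phi>" using le1 by (simp add: \<Phi>_def)
    then have "norm (Blinfun \<phi>) \<le> M" by (rule M(2))
    then have "\<bar>\<phi> z\<bar> \<le> M * norm z"
      using norm_blinfun[of "Blinfun \<phi>" z] mult_right_mono[of "norm (Blinfun \<phi>)" M "norm z"] by (simp add: ap)
    also have "\<dots> < 1" using z M(1) by (simp add: field_simps)
    finally show False using ge \<phi>(3) by simp
  qed
  then have "ball 0 (1 / M) \<subseteq> V0" by (auto simp: V_def)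
  with M(1) show "\<exists>e>0. ball 0 e \<subseteq> V0" by (intro exI[of _ "1 / M"]) auto
qed

lemma topological_dual_euclidean:
  "topological_dual (euclidean :: 'e::real_normed_vector topology) = range (blinfun_apply :: ('e \<Rightarrow>\<^sub>L real) \<Rightarrow> _)"
proof (intro set_eqI iffI)
  fix \<phi> :: "'e \<Rightarrow> real"
  assume "\<phi> \<in> topological_dual euclidean"
  then have \<phi>: "linear \<phi>" "continuous_on UNIV \<phi>"
    by (auto simp: topological_dual_def)
  from \<phi>(2) obtain d where d: "0 < d" "\<And>x. norm x < d \<Longrightarrow> \<bar>\<phi> x\<bar> < 1"
    using linear_0[OF \<phi>(1)] unfolding continuous_on_iff by (metis UNIV_I dist_0_norm dist_commute real_norm_def zero_less_one)
  have "\<bar>\<phi> x\<bar> \<le> norm x * (2 / d)" for x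
  proof (cases "x = 0")
    case False
    have "\<bar>\<phi> ((d / (2 * norm x)) *\<^sub>R x)\<bar> < 1"
      using d(1) False by (intro d(2)) simp
    then show ?thesis
      using d(1) False by (simp add: linear_scale[OF \<phi>(1)] abs_mult field_simps)
  qed (simp add: linear_0[OF \<phi>(1)])
  then have "bounded_linear \<phi>"
    using \<phi>(1) by (intro bounded_linear_intro[of _ "2 / d"]) (auto simp: linear_add linear_scale)
  then have "\<phi> = blinfun_apply (Blinfun \<phi>)" by (simp add: bounded_linear_Blinfun_apply)
  then show "\<phi> \<in> range (blinfun_apply :: ('e \<Rightarrow>\<^sub>L real) \<Rightarrow> _)" by blast
next
  fix \<phi> :: "'e \<Rightarrow> real"
  assume "\<phi> \<in> range (blinfun_apply :: ('e \<Rightarrow>\<^sub>L real) \<Rightarrow> _)"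
  then show "\<phi> \<in> topological_dual euclidean"
    by (auto simp: topological_dual_def blinfun.bounded_linear_right bounded_linear.linear
        intro!: linear_continuous_on)
qed

text \<open>The preceding comparison is applied to the Banach space \<open>X^*\<close>, where having
  dual \<open>X^**\<close> means that the continuous functionals are the norm bounded ones.\<close>

lemma is_finest_lc_has_dual_bidual:
  "is_finest_lc has_dual_bidual (euclidean :: ('a::real_normed_vector \<Rightarrow>\<^sub>L real) topology)"
  unfolding is_finest_lc_def has_dual_bidual_def
  by (auto simp: locally_convex_euclidean topological_dual_euclidean blinfun.bounded_linear_right
      intro!: coarser_norm_of_dual_bounded)

section \<open>Bounded sets and the bound extension\<close>

lemma bounded_in_euclidean_iff:
  fixes B :: "'e::real_normed_vector set"
  shows "bounded_in euclidean B \<longleftrightarrow> bounded B"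
proof
  assume "bounded_in euclidean B"
  then have "absorbs (ball 0 1) B" by (simp add: bounded_in_def)
  then obtain r where r: "0 < r" "\<forall>c. r \<le> \<bar>c\<bar> \<longrightarrow> B \<subseteq> (\<lambda>x. c *\<^sub>R x) ` ball 0 1"
    unfolding absorbs_def by blast
  then have "B \<subseteq> (\<lambda>x. r *\<^sub>R x) ` ball 0 1" by simp
  then show "bounded B" by (rule bounded_subset[rotated]) (intro bounded_scaling bounded_ball)
next
  assume "bounded B"
  then obtain M where M: "0 < M" "\<And>x. x \<in> B \<Longrightarrow> norm x \<le> M" by (auto simp: bounded_pos)
  show "bounded_in euclidean B"
    unfolding bounded_in_def open_openin[symmetric]
  proof (intro allI impI)
    fix U :: "'e set" assume "open U" "0 \<in> U"
    then obtain e where e: "0 < e" "ball 0 e \<subseteq> U" by (meson openE)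
    \<comment> \<open>The factor 2 turns the bound \<open>norm x \<le> M\<close> into membership in
      the open ball of radius \<open>\<bar>c\<bar> * e\<close>.\<close>
    have "B \<subseteq> (\<lambda>x. c *\<^sub>R x) ` U" if c: "2 * M / e \<le> \<bar>c\<bar>" for c
    proof
      fix x assume x: "x \<in> B"
      have "0 < 2 * M / e" using M(1) e(1) by simp
      with c have c0: "0 < \<bar>c\<bar>" by linarith
      have "norm x < \<bar>c\<bar> * e"
        using M(2)[OF x] M(1) c e(1) by (simp add: field_simps)
      then have "norm (inverse c *\<^sub>R x) < e"
        using c0 by (simp add: field_simps)
      then have "inverse c *\<^sub>R x \<in> U" using e(2) by auto
      with c0 show "x \<in> (\<lambda>x. c *\<^sub>R x) ` U" by (intro image_eqI[of _ _ "inverse c *\<^sub>R x"]) auto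
    qed
    moreover have "0 < 2 * M / e" using M(1) e(1) by simp
    ultimately show "absorbs U B" unfolding absorbs_def by blast
  qed
qed

text \<open>The assumptions say that \<open>T\<close> has the norm bounded sets as its bounded sets.
  A disc absorbing the unit ball contains a multiple of it, and balls are discs absorbing all
  bounded sets.\<close>

lemma bound_extension_eq_euclidean:
  fixes T :: "'e::real_normed_vector topology"
  assumes T: "T \<preceq> euclidean" and bdd: "\<And>B. bounded_in T B \<Longrightarrow> bounded B"
  shows "bound_extension T = euclidean"
  unfolding topology_eq open_openin[symmetric] openin_bound_extension
proof (intro allI iffI)
  fix S assume S: "\<forall>x\<in>S. \<exists>V\<in>bornivorous_discs T. (\<lambda>v. x + v) ` V \<subseteq> S"
  show "open S"
    unfolding open_contains_ball
  proof
    fix x assume "x \<in> S"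
    with S obtain V where V: "V \<in> bornivorous_discs T" "(\<lambda>v. x + v) ` V \<subseteq> S" by blast
    have "bounded_in T (ball 0 1)"
      by (rule coarser_bounded_in[OF T]) (simp add: bounded_in_euclidean_iff)
    with V(1) have "absorbs V (ball 0 1)" by (simp add: bornivorous_discs_def)
    then obtain r where r: "0 < r" "\<forall>c. r \<le> \<bar>c\<bar> \<longrightarrow> ball 0 1 \<subseteq> (\<lambda>x. c *\<^sub>R x) ` V"
      unfolding absorbs_def by blast
    have "ball x (1 / r) \<subseteq> S"
    proof
      fix y assume "y \<in> ball x (1 / r)"
      then have "r *\<^sub>R (y - x) \<in> ball 0 1"
        using r(1) by (simp add: dist_norm norm_minus_commute[of x] pos_less_divide_eq mult.commute
            del: scaleR_diff_right scaleR_right_diff_distrib)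
      moreover have "ball 0 1 \<subseteq> (\<lambda>x. r *\<^sub>R x) ` V" using r by simp
      ultimately have "r *\<^sub>R (y - x) \<in> (\<lambda>x. r *\<^sub>R x) ` V" by blast
      then have "y - x \<in> V" using r(1) by auto
      then have "x + (y - x) \<in> S" using V(2) by blast
      then show "y \<in> S" by simp
    qed
    with r(1) show "\<exists>e>0. ball x e \<subseteq> S" by (intro exI[of _ "1 / r"]) auto
  qed
next
  fix S :: "'e set" assume S: "open S"
  show "\<forall>x\<in>S. \<exists>V\<in>bornivorous_discs T. (\<lambda>v. x + v) ` V \<subseteq> S"
  proof
    fix x assume "x \<in> S"
    with S obtain e where e: "0 < e" "ball x e \<subseteq> S" by (meson openE)
    have "circled (ball 0 e :: 'e set)"
      unfolding circled_def
    proof (intro allI impI)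
      fix c :: real and y :: 'e assume "\<bar>c\<bar> \<le> 1" "y \<in> ball 0 e"
      then show "c *\<^sub>R y \<in> ball 0 e"
        using mult_right_mono[of "\<bar>c\<bar>" 1 "norm y"] by simp
    qed
    moreover have "absorbs (ball 0 e) B" if "bounded_in T B" for B
    proof -
      have "bounded_in euclidean B" using bdd[OF that] by (simp add: bounded_in_euclidean_iff)
      then show ?thesis using e(1) by (simp add: bounded_in_def)
    qed
    ultimately have "ball 0 e \<in> bornivorous_discs T" by (simp add: bornivorous_discs_def)
    moreover have "(\<lambda>v. x + v) ` ball 0 e \<subseteq> S" using e(2) by (auto simp: dist_norm)
    ultimately show "\<exists>V\<in>bornivorous_discs T. (\<lambda>v. x + v) ` V \<subseteq> S" by blast
  qed
qed


section \<open>Comparison of the topologies\<close>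

lemma topspace_mackey_topology: "topspace mackey_topology = UNIV"
proof -
  have "UNIV \<in> uniform_nhds_0 \<K>" for \<K> :: "'a set set"
    unfolding uniform_nhds_0_def by (intro CollectI exI[of _ "{}"] exI[of _ 1]) simp
  then have "openin mackey_topology (UNIV :: ('a \<Rightarrow>\<^sub>L real) set)"
    unfolding mackey_topology_def openin_uniform_convergence_topology by blast
  then show ?thesis using openin_subset by blast
qed

lemma norm_mackey_same_convergent_sequences:
  assumes "\<not> contains_l1 TYPE('a::banach)"
  shows "same_convergent_sequences euclidean (mackey_topology :: ('a \<Rightarrow>\<^sub>L real) topology)"
  unfolding same_convergent_sequences_def limitin_canonical_iff
  using mackey_limit_imp_norm_limit[OF assms]
    coarser_limitin[OF mackey_coarser_norm[unfolded dual_norm_topology_def] topspace_mackey_topology]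
  by fastforce

lemma norm_mackey_same_precompact_sets:
  assumes "\<not> contains_l1 TYPE('a::banach)"
  shows "same_precompact_sets euclidean (mackey_topology :: ('a \<Rightarrow>\<^sub>L real) topology)"
  unfolding same_precompact_sets_def
  using mackey_precompact_imp_norm_precompact[OF assms, unfolded dual_norm_topology_def]
    coarser_precompact_in[OF mackey_coarser_norm[unfolded dual_norm_topology_def]]
  by blast

theorem corollary3p12:
  fixes \<tau> :: "('a::banach \<Rightarrow>\<^sub>L real) topology"
  assumes "\<not> contains_l1 TYPE('a)"
    and "\<tau> = mackey_topology"
  shows "is_finest_lc (\<lambda>S. same_convergent_sequences S \<tau>) (tau_plus \<tau>)
       \<and> is_finest_lc (\<lambda>S. same_precompact_sets S \<tau>) (tau_p \<tau>)
       \<and> is_finest_lc has_dual_bidual (mackey_topology_bidual :: ('a \<Rightarrow>\<^sub>L real) topology)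
       \<and> \<tau> \<preceq> tau_plus \<tau>
       \<and> tau_plus \<tau> = tau_p \<tau>
       \<and> tau_p \<tau> = bound_extension \<tau>
       \<and> bound_extension \<tau> = dual_norm_topology
       \<and> tau_p \<tau> = mackey_topology_bidual
       \<and> mackey_topology_bidual = (dual_norm_topology :: ('a \<Rightarrow>\<^sub>L real) topology)
       \<and> bornological (tau_p \<tau>)"
proof -
  have seq: "is_finest_lc (\<lambda>S. same_convergent_sequences S \<tau>) euclidean"
    unfolding assms(2)
    by (rule is_finest_lc_same_convergent_sequences[OF norm_mackey_same_convergent_sequences[OF assms(1)]])
  have pre: "is_finest_lc (\<lambda>S. same_precompact_sets S \<tau>) euclidean"
    unfolding assms(2)
    by (rule is_finest_lc_same_precompact_sets[OF norm_mackey_same_precompact_sets[OF assms(1)]])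
  note dual = is_finest_lc_has_dual_bidual[where 'a = 'a]
  have plus: "tau_plus \<tau> = euclidean" and p: "tau_p \<tau> = euclidean"
    and bidual: "mackey_topology_bidual = (euclidean :: ('a \<Rightarrow>\<^sub>L real) topology)"
    unfolding tau_plus_def tau_p_def mackey_topology_bidual_def
    using seq pre dual by (simp_all add: finest_lc_eq)
  have coarser: "\<tau> \<preceq> euclidean"
    using mackey_coarser_norm unfolding assms(2) dual_norm_topology_def .
  have bound: "bound_extension \<tau> = euclidean"
    by (rule bound_extension_eq_euclidean[OF coarser]) (simp add: assms(2) bounded_in_mackey_imp_bounded)
  \<comment> \<open>Being bornological concerns the bound extension of \<open>tau_p \<tau>\<close>
    itself, so the lemma is applied a second time, to the norm topology.\<close>
  have "bound_extension (euclidean :: ('a \<Rightarrow>\<^sub>L real) topology) = euclidean"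
    by (rule bound_extension_eq_euclidean) (simp_all add: coarser_def bounded_in_euclidean_iff)
  then have "bornological (euclidean :: ('a \<Rightarrow>\<^sub>L real) topology)"
    unfolding bornological_def using locally_convex_euclidean by simp
  with seq pre dual coarser show ?thesis
    by (simp add: plus p bidual bound dual_norm_topology_def)
qed

end
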